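(* Fix $c>1$. Any randomized cell-probe data structure that solves the decision version of ANN on the Hamming random instance with probability at least $2/3$, uses cells of $w=o(\log n)$ bits, and reads at most two cells per query (possibly adaptively), must use at least $n^{\left(\frac{c}{c-1}\right)^2-o(1)}$ cells.
   Context: Hamming random instance with $d=\omega(\log n)$: $n$ data points drawn independently and uniformly from $\{-1,1\}^d$; the query $q$ is obtained by choosing a data point $p$ uniformly at random and flipping each coordinate independently with probability $\frac{1}{2c}$. Decision version of ANN: each data point $p$ carries a bit $x_p\in\{0,1\}$ (stored as part of the input to preprocessing); given the query $q$ generated from the planted point $p$, the data structure must output $x_p$. Cell-probe model: a table of cells of $w$ bits computed from the dataset and bits; the query reads cells, cost = number of cells read, space = number of cells. *)

theory Defs
  imports "HOL-Probability.Probability"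
begin

definition cube :: "nat \<Rightarrow> int list set" where
  "cube d = {p. length p = d \<and> set p \<subseteq> {-1, 1}}"

definition dataset_pmf :: "nat \<Rightarrow> nat \<Rightarrow> int list list pmf" where
  "dataset_pmf n d = pmf_of_set {P. length P = n \<and> set P \<subseteq> cube d}"

fun noise_pmf :: "real \<Rightarrow> int list \<Rightarrow> int list pmf" where
  "noise_pmf \<delta> [] = return_pmf []"
| "noise_pmf \<delta> (a # p) =
     bind_pmf (bernoulli_pmf \<delta>) (\<lambda>b. bind_pmf (noise_pmf \<delta> p)
       (\<lambda>q. return_pmf ((if b then - a else a) # q)))"

definition query_pmf :: "real \<Rightarrow> int list list \<Rightarrow> (nat \<times> int list) pmf" where
  "query_pmf c P = bind_pmf (pmf_of_set {..<length P})
     (\<lambda>i. map_pmf (\<lambda>q. (i, q)) (noise_pmf (1 / (2 * c)) (P ! i)))"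

text \<open>Two-probe (adaptive) cell-probe data structure with public randomness r:
  table T r P x : address \<Rightarrow> cell content (w bits as a bool list),
  first probe A1 r q, second probe A2 r q c1, output Out r q c1 c2.
  Validity: s cells of exactly w bits, probes land in the table.\<close>
definition valid_two_probe ::
  "nat \<Rightarrow> nat \<Rightarrow> nat \<Rightarrow> nat \<Rightarrow> ('r \<Rightarrow> int list list \<Rightarrow> bool list \<Rightarrow> nat \<Rightarrow> bool list)
   \<Rightarrow> ('r \<Rightarrow> int list \<Rightarrow> nat) \<Rightarrow> ('r \<Rightarrow> int list \<Rightarrow> bool list \<Rightarrow> nat) \<Rightarrow> bool" where
  "valid_two_probe d n w s T A1 A2 \<longleftrightarrow>
     (\<forall>r P x a. length P = n \<and> set P \<subseteq> cube d \<and> length x = n \<and> a < s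
        \<longrightarrow> length (T r P x a) = w) \<and>
     (\<forall>r q. q \<in> cube d \<longrightarrow> A1 r q < s) \<and>
     (\<forall>r q cc. q \<in> cube d \<and> length cc = w \<longrightarrow> A2 r q cc < s)"

definition success_prob ::
  "real \<Rightarrow> nat \<Rightarrow> nat \<Rightarrow> 'r pmf \<Rightarrow> ('r \<Rightarrow> int list list \<Rightarrow> bool list \<Rightarrow> nat \<Rightarrow> bool list)
   \<Rightarrow> ('r \<Rightarrow> int list \<Rightarrow> nat) \<Rightarrow> ('r \<Rightarrow> int list \<Rightarrow> bool list \<Rightarrow> nat)
   \<Rightarrow> ('r \<Rightarrow> int list \<Rightarrow> bool list \<Rightarrow> bool list \<Rightarrow> bool) \<Rightarrow> bool list \<Rightarrow> real" where
  "success_prob c n d R T A1 A2 Out x =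
     measure_pmf.prob
       (bind_pmf R (\<lambda>r. bind_pmf (dataset_pmf n d) (\<lambda>P.
          map_pmf (\<lambda>(i, q). (r, P, i, q)) (query_pmf c P))))
       {(r, P, i, q). let c1 = T r P x (A1 r q); c2 = T r P x (A2 r q c1)
                      in Out r q c1 c2 = x ! i}"

end

theory Submission
  imports Defs
begin

text \<open>Average over a uniformly random bit vector \<open>x\<close> and fix the random string. Guessing the contents of
  the two probed cells turns the correlation between the output and the planted bit into \<open>4 ^ w\<close>
  bilinear forms in functions of the table, each with matrix \<open>Z = (\<Sum>i. \<chi>\<^sub>i H\<^sub>i)\<close>, where \<open>\<chi>\<^sub>i\<close>
  is the sign of \<open>x\<^sub>i\<close> and \<open>H\<^sub>i(a, b)\<close> is, up to signs, the probability that a query planted at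
  the \<open>i\<close>-th point probes \<open>a\<close> and \<open>b\<close>.

  With \<open>\<rho> = 1 - 1 / c\<close>, hypercontractivity shows that, conditioned on the query lying in a set
  of measure at least \<open>n powr (\<epsilon> - 1 / \<rho>\<^sup>2)\<close>, the planted point has density at most
  \<open>L = n powr (1 - \<epsilon>')\<close>, apart from an event of polynomially small probability. If the table has
  fewer than \<open>n powr (1 / \<rho>\<^sup>2 - \<epsilon>)\<close> cells, this applies to the set of queries probing a typical cell.
  For the truncated matrices the trace of a constant even power of \<open>Z\<close>, normalised by the cell
  probabilities, is a sum over closed walks; the signs leave only walks in which every data point
  occurs at least twice, and this gives a norm of about \<open>sqrt (n * L)\<close>. Hence the advantage is
  polynomially small, while \<open>4 ^ w\<close> is \<open>n powr o(1)\<close>.\<close>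

section \<open>Hypercontractivity of the noise operator\<close>

lemma one_plus_mult_le_powr:
  fixes r y :: real
  assumes "r \<ge> 1" "y \<ge> 0"
  shows "1 + r * y \<le> (1 + y) powr r"
proof -
  let ?f = "\<lambda>y. (1 + y) powr r - (1 + r * y)"
  have "?f 0 \<le> ?f y"
  proof (rule DERIV_nonneg_imp_nondecreasing[OF assms(2)])
    fix x :: real
    assume x: "0 \<le> x" "x \<le> y"
    have "DERIV ?f x :> r * (1 + x) powr (r - 1) - r"
      using x by (auto intro!: derivative_eq_intros simp: powr_diff field_simps)
    moreover have "(1 + x) powr (r - 1) \<ge> 1"
      using x assms(1) by (simp add: ge_one_powr_ge_zero)
    hence "r * 1 \<le> r * (1 + x) powr (r - 1)"
      using assms(1) by (intro mult_left_mono) auto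
    ultimately show "\<exists>y. DERIV ?f x :> y \<and> y \<ge> 0" by force
  qed
  thus ?thesis by simp
qed

lemma continuous_on_affine_powr:
  fixes k r :: real
  assumes "r > 0" "\<And>x. x \<in> S \<Longrightarrow> 0 \<le> 1 + k * x"
  shows "continuous_on S (\<lambda>x. (1 + k * x) powr r)"
  by (rule continuous_on_powr') (use assms in \<open>auto intro!: continuous_intros\<close>)

text \<open>An even convex function increases on the nonnegative side. This absorbs the contraction
  \<open>\<rho> * u \<le> u\<close> when second derivatives are compared in
  \<open>two_point_normalized\<close>.\<close>

lemma powr_even_part_mono_arg:
  fixes \<alpha> x a :: real
  assumes "0 < \<alpha>" "0 \<le> x" "x \<le> a" "a < 1"
  shows "(1 + x) powr -\<alpha> + (1 - x) powr -\<alpha> \<le> (1 + a) powr -\<alpha> + (1 - a) powr -\<alpha>"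
proof -
  let ?f = "\<lambda>x. (1 + x) powr -\<alpha> + (1 - x) powr -\<alpha>"
  show ?thesis
  proof (rule DERIV_nonneg_imp_nondecreasing[OF assms(3), of ?f])
    fix t :: real
    assume t: "x \<le> t" "t \<le> a"
    have "DERIV ?f t :> \<alpha> * (1 - t) powr (-\<alpha> - 1) - \<alpha> * (1 + t) powr (-\<alpha> - 1)"
      using t assms by (auto intro!: derivative_eq_intros simp: powr_diff field_simps)
    moreover have "(1 + t) powr (-\<alpha> - 1) \<le> (1 - t) powr (-\<alpha> - 1)"
      using t assms by (intro powr_mono2') auto
    hence "\<alpha> * (1 + t) powr (-\<alpha> - 1) \<le> \<alpha> * (1 - t) powr (-\<alpha> - 1)"
      using assms(1) by (intro mult_left_mono) auto
    ultimately show "\<exists>y. DERIV ?f t :> y \<and> y \<ge> 0" by force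
  qed
qed

text \<open>Raising the exponent multiplies the two terms by \<open>y\<close> and \<open>z\<close>
  with \<open>y * z \<ge> 1\<close>, so \<open>y + z \<ge> 2\<close> by AM-GM. The gain
  \<open>z - 1\<close> is thus at least the loss \<open>1 - y\<close>, and it falls on the larger
  term. This absorbs the change of exponent from \<open>2 - p\<close> to
  \<open>2 - q\<close>.\<close>

lemma powr_even_part_mono_exp:
  fixes \<alpha> \<beta> a :: real
  assumes "0 < \<alpha>" "\<alpha> \<le> \<beta>" "0 \<le> a" "a < 1"
  shows "(1 + a) powr -\<alpha> + (1 - a) powr -\<alpha> \<le> (1 + a) powr -\<beta> + (1 - a) powr -\<beta>"
proof -
  define y where "y = (1 + a) powr -(\<beta> - \<alpha>)"
  define z where "z = (1 - a) powr -(\<beta> - \<alpha>)"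
  have pos: "y > 0" "z > 0" using assms by (auto simp: y_def z_def)
  have yz: "y * z = (1 - a\<^sup>2) powr -(\<beta> - \<alpha>)"
    using assms by (simp add: y_def z_def powr_mult[symmetric] power2_eq_square algebra_simps)
  have a2: "0 < 1 - a\<^sup>2" "1 - a\<^sup>2 \<le> 1"
    using assms by (auto simp: power_less_one_iff abs_square_less_1)
  have yz1: "y * z \<ge> 1"
  proof -
    have "1 powr -(\<beta> - \<alpha>) \<le> (1 - a\<^sup>2) powr -(\<beta> - \<alpha>)"
      using a2 assms by (intro powr_mono2') auto
    thus ?thesis using yz by simp
  qed
  have "4 \<le> (y - z)\<^sup>2 + 4 * (y * z)" using yz1 zero_le_power2[of "y - z"] by linarith
  also have "\<dots> = (y + z)\<^sup>2" by (simp add: power2_eq_square algebra_simps)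
  finally have "2\<^sup>2 \<le> (y + z)\<^sup>2" by simp
  hence yz2: "2 \<le> y + z" by (rule power2_le_imp_le) (use pos in simp)
  have z1: "z \<ge> 1" 
  proof -
    have "1 powr -(\<beta> - \<alpha>) \<le> (1 - a) powr -(\<beta> - \<alpha>)"
      using assms by (intro powr_mono2') auto
    thus ?thesis by (simp add: z_def)
  qed
  have mono: "(1 + a) powr -\<alpha> \<le> (1 - a) powr -\<alpha>"
    using assms by (intro powr_mono2') auto
  have "(1 + a) powr -\<alpha> * (1 - y) \<le> (1 + a) powr -\<alpha> * (z - 1)"
    using yz2 by (intro mult_left_mono) auto
  also have "\<dots> \<le> (1 - a) powr -\<alpha> * (z - 1)"
    using z1 mono by (intro mult_right_mono) auto
  finally have "(1 + a) powr -\<alpha> * (1 - y) \<le> (1 - a) powr -\<alpha> * (z - 1)" .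
  moreover have "(1 + a) powr -\<alpha> * y = (1 + a) powr -\<beta>" "(1 - a) powr -\<alpha> * z = (1 - a) powr -\<beta>"
    by (simp_all add: y_def z_def powr_add[symmetric])
  ultimately show ?thesis by (simp add: algebra_simps)
qed

text \<open>Both sides are even in \<open>a\<close> and vanish at \<open>0\<close>, so it is enough to compare second
  derivatives; the factor \<open>\<rho>\<^sup>2 * t\<close> is the same on both sides because \<open>q - 1 = \<rho>\<^sup>2 * (p - 1)\<close>.\<close>

lemma two_point_normalized:
  fixes t \<rho> a :: real
  defines "p \<equiv> 1 + t" and "q \<equiv> 1 + \<rho>\<^sup>2 * t"
  assumes t: "0 < t" "t < 1" and \<rho>: "0 < \<rho>" "\<rho> \<le> 1" and a: "0 \<le> a" "a \<le> 1"
  shows "((1 + \<rho> * a) powr p + (1 - \<rho> * a) powr p) / 2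
    \<le> (((1 + a) powr q + (1 - a) powr q) / 2) powr (p / q)"
proof -
  have r2: "0 < \<rho>\<^sup>2" "\<rho>\<^sup>2 \<le> 1" using \<rho> by (auto simp: power_le_one)
  have pq: "1 < q" "q \<le> p" "p < 2"
    using t r2 by (auto simp: p_def q_def mult_le_cancel_right1)
  have ra: "0 \<le> \<rho> * x" "\<rho> * x \<le> x" if "0 \<le> x" for x
    using \<rho> that by (auto simp: mult_left_le_one_le)
  \<comment> \<open>Up to the factor \<open>p / 2\<close> this is the derivative of
    \<open>\<phi>\<close> below, so the sign of its own derivative settles both functions.\<close>
  define \<psi> where "\<psi> = (\<lambda>x. (1 + x) powr (q - 1) - (1 - x) powr (q - 1)
    - \<rho> * ((1 + \<rho> * x) powr (p - 1) - (1 - \<rho> * x) powr (p - 1)))"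
  have \<psi>_nonneg: "\<psi> x \<ge> 0" if x: "0 \<le> x" "x < 1" for x
  proof -
    have "\<psi> 0 \<le> \<psi> x"
    proof (rule DERIV_nonneg_imp_nondecreasing[OF x(1)])
      fix u :: real
      assume u: "0 \<le> u" "u \<le> x"
      have ru: "\<rho> * u < 1" using ra[OF u(1)] u x by linarith
      let ?D = "\<rho>\<^sup>2 * t * (((1 + u) powr -(2 - q) + (1 - u) powr -(2 - q))
         - ((1 + \<rho> * u) powr -(2 - p) + (1 - \<rho> * u) powr -(2 - p)))"
      have pos: "1 + u > 0" "1 - u > 0" "1 + \<rho> * u > 0" "1 - \<rho> * u > 0"
        using u x ru ra[OF u(1)] by auto
      have e: "q - 1 - 1 = -(2 - q)" "p - 1 - 1 = -(2 - p)" by auto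
      have d1: "DERIV (\<lambda>x. (1 + x) powr (q - 1)) u :> (q - 1) * (1 + u) powr -(2 - q) * 1"
        unfolding e(1)[symmetric] by (rule DERIV_fun_powr[where r="q - 1", simplified of_nat_1]) (use pos in \<open>auto intro!: derivative_eq_intros\<close>)
      have d2: "DERIV (\<lambda>x. (1 - x) powr (q - 1)) u :> (q - 1) * (1 - u) powr -(2 - q) * (-1)"
        unfolding e(1)[symmetric] by (rule DERIV_fun_powr[where r="q - 1", simplified of_nat_1]) (use pos in \<open>auto intro!: derivative_eq_intros\<close>)
      have d3: "DERIV (\<lambda>x. (1 + \<rho> * x) powr (p - 1)) u :> (p - 1) * (1 + \<rho> * u) powr -(2 - p) * \<rho>"
        unfolding e(2)[symmetric] by (rule DERIV_fun_powr[where r="p - 1", simplified of_nat_1]) (use pos in \<open>auto intro!: derivative_eq_intros\<close>)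
      have d4: "DERIV (\<lambda>x. (1 - \<rho> * x) powr (p - 1)) u :> (p - 1) * (1 - \<rho> * u) powr -(2 - p) * (-\<rho>)"
        unfolding e(2)[symmetric] by (rule DERIV_fun_powr[where r="p - 1", simplified of_nat_1]) (use pos in \<open>auto intro!: derivative_eq_intros\<close>)
      have "DERIV \<psi> u :> ?D"
        unfolding \<psi>_def
        by (rule DERIV_cong[OF DERIV_diff[OF DERIV_diff[OF d1 d2] DERIV_cmult[OF DERIV_diff[OF d3 d4]]]])
          (simp add: p_def q_def algebra_simps power2_eq_square)
      moreover have "?D \<ge> 0"
      proof -
        have "(1 + \<rho> * u) powr -(2 - p) + (1 - \<rho> * u) powr -(2 - p)
          \<le> (1 + u) powr -(2 - p) + (1 - u) powr -(2 - p)"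
          using pq ra[OF u(1)] u x by (intro powr_even_part_mono_arg) auto
        also have "\<dots> \<le> (1 + u) powr -(2 - q) + (1 - u) powr -(2 - q)"
          using pq u x by (intro powr_even_part_mono_exp) auto
        finally show ?thesis using t by (intro mult_nonneg_nonneg) auto
      qed
      ultimately show "\<exists>y. DERIV \<psi> u :> y \<and> y \<ge> 0" by blast
    qed
    thus ?thesis by (simp add: \<psi>_def)
  qed
  define \<phi> where "\<phi> = (\<lambda>x. (p / q) * (((1 + x) powr q + (1 - x) powr q) / 2 - 1)
    - (((1 + \<rho> * x) powr p + (1 - \<rho> * x) powr p) / 2 - 1))"
  have "\<phi> 0 \<le> \<phi> a"
  \<comment> \<open>The endpoint \<open>a = 1\<close> is allowed, where \<open>1 - x\<close> reaches
    zero. Derivatives are therefore taken on the open interval, with continuity up to the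
    boundary.\<close>
  proof (rule DERIV_nonneg_imp_increasing_open[OF a(1)])
    fix u :: real
    assume u: "0 < u" "u < a"
    have pos: "1 + u > 0" "1 - u > 0" "1 + \<rho> * u > 0" "1 - \<rho> * u > 0"
      using u a ra[of u] by linarith+
    have d1: "DERIV (\<lambda>x. (1 + x) powr q) u :> q * (1 + u) powr (q - 1) * 1"
      by (rule DERIV_fun_powr[where r=q, simplified of_nat_1]) (use pos in \<open>auto intro!: derivative_eq_intros\<close>)
    have d2: "DERIV (\<lambda>x. (1 - x) powr q) u :> q * (1 - u) powr (q - 1) * (-1)"
      by (rule DERIV_fun_powr[where r=q, simplified of_nat_1]) (use pos in \<open>auto intro!: derivative_eq_intros\<close>)
    have d3: "DERIV (\<lambda>x. (1 + \<rho> * x) powr p) u :> p * (1 + \<rho> * u) powr (p - 1) * \<rho>"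
      by (rule DERIV_fun_powr[where r=p, simplified of_nat_1]) (use pos in \<open>auto intro!: derivative_eq_intros\<close>)
    have d4: "DERIV (\<lambda>x. (1 - \<rho> * x) powr p) u :> p * (1 - \<rho> * u) powr (p - 1) * (-\<rho>)"
      by (rule DERIV_fun_powr[where r=p, simplified of_nat_1]) (use pos in \<open>auto intro!: derivative_eq_intros\<close>)
    note d = DERIV_diff[OF
        DERIV_cmult[OF DERIV_diff[OF DERIV_cdivide[OF DERIV_add[OF d1 d2], of 2] DERIV_const[of 1]], of "p / q"]
        DERIV_diff[OF DERIV_cdivide[OF DERIV_add[OF d3 d4], of 2] DERIV_const[of 1]]]
    have "DERIV \<phi> u :> p / 2 * \<psi> u"
      unfolding \<phi>_def by (rule DERIV_cong[OF d]) (use pq in \<open>simp add: \<psi>_def field_simps\<close>)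
    moreover have "p / 2 * \<psi> u \<ge> 0" using \<psi>_nonneg[of u] u a pq by auto
    ultimately show "\<exists>y. DERIV \<phi> u :> y \<and> y \<ge> 0" by blast
  next
    have rx: "\<rho> * x \<le> 1" if "0 \<le> x" "x \<le> a" for x
      using ra(2)[of x] that a by linarith
    have nn: "0 \<le> 1 + \<rho> * x" if "0 \<le> x" for x using ra(1)[of x] that by linarith
    have q0: "q > 0" and p0: "p > 0" using pq by auto
    have c1: "continuous_on {0..a} (\<lambda>x. (1 + x) powr q)"
      by (rule continuous_on_affine_powr[OF q0, where k = 1, unfolded mult_1]) auto
    have c2: "continuous_on {0..a} (\<lambda>x. (1 + (-1) * x) powr q)"
      by (rule continuous_on_affine_powr[OF q0]) (use a in auto)
    have c3: "continuous_on {0..a} (\<lambda>x. (1 + \<rho> * x) powr p)"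
      by (rule continuous_on_affine_powr[OF p0]) (simp add: nn)
    have c4: "continuous_on {0..a} (\<lambda>x. (1 + (- \<rho>) * x) powr p)"
      by (rule continuous_on_affine_powr[OF p0]) (simp add: rx)
    note c = c1 c2[unfolded mult_minus_left mult_1 add_uminus_conv_diff] c3
      c4[unfolded mult_minus_left add_uminus_conv_diff]
    show "continuous_on {0..a} \<phi>"
      unfolding \<phi>_def by (intro continuous_on_diff continuous_on_mult continuous_on_divide
          continuous_on_add continuous_on_const c) auto
  qed
  hence "(((1 + \<rho> * a) powr p + (1 - \<rho> * a) powr p) / 2 - 1) \<le> (p / q) * (((1 + a) powr q + (1 - a) powr q) / 2 - 1)"
    by (simp add: \<phi>_def)
  \<comment> \<open>Bernoulli's inequality turns the linear factor \<open>p / q\<close> into the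
    exponent \<open>p / q\<close>.\<close>
  also have "1 + (p / q) * (((1 + a) powr q + (1 - a) powr q) / 2 - 1)
     \<le> (1 + (((1 + a) powr q + (1 - a) powr q) / 2 - 1)) powr (p / q)"
  proof (rule one_plus_mult_le_powr)
    show "1 \<le> p / q" using pq by simp
    have "1 + q * a \<le> (1 + a) powr q" using pq a by (intro one_plus_mult_le_powr) auto
    \<comment> \<open>\<open>one_plus_mult_le_powr\<close> covers nonnegative increments only, so
      the tangent bound on the side of \<open>1 - a\<close> is proved separately.\<close>
    moreover have "1 - q * a \<le> (1 - a) powr q"
    proof -
      let ?f = "\<lambda>x. (1 - x) powr q - (1 - q * x)"
      have "?f 0 \<le> ?f a"
      proof (rule DERIV_nonneg_imp_increasing_open[OF a(1)])
        fix u :: real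
        assume u: "0 < u" "u < a"
        have "DERIV ?f u :> q * (1 - (1 - u) powr (q - 1))"
          using u a by (auto intro!: derivative_eq_intros simp: powr_diff field_simps)
        moreover have "(1 - u) powr (q - 1) \<le> 1" using u a pq by (intro powr_le1) auto
        ultimately show "\<exists>y. DERIV ?f u :> y \<and> y \<ge> 0" using pq 
          by (intro exI[of _ "q * (1 - (1 - u) powr (q - 1))"]) auto
      next
        have "continuous_on {0..a} (\<lambda>x. (1 + (-1) * x) powr q)"
          using pq a by (intro continuous_on_affine_powr) auto
        hence "continuous_on {0..a} (\<lambda>x. (1 - x) powr q)" by simp
        thus "continuous_on {0..a} ?f"
          by (intro continuous_on_diff continuous_on_mult continuous_on_const continuous_on_id)
      qed
      thus ?thesis by simp
    qed
    ultimately show "0 \<le> ((1 + a) powr q + (1 - a) powr q) / 2 - 1" by simp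
  qed
  finally show ?thesis by simp
qed

text \<open>Young's inequality is applied to each product after both vectors are scaled to norm one.
  The case of a zero vector, which cannot be scaled, is split off first.\<close>

lemma Holder_two:
  fixes a b x y p r :: real
  assumes "p > 1" "r > 1" "1 / r + 1 / p = 1" "a \<ge> 0" "b \<ge> 0" "x \<ge> 0" "y \<ge> 0"
  shows "a * x + b * y \<le> (a powr r + b powr r) powr (1 / r) * (x powr p + y powr p) powr (1 / p)"
proof (cases "(a = 0 \<and> b = 0) \<or> (x = 0 \<and> y = 0)")
  case True
  thus ?thesis by auto
next
  case False
  define A where "A = a powr r + b powr r"
  define B where "B = x powr p + y powr p"
  have pos: "A > 0" "B > 0"
    using False assms by (auto simp: A_def B_def add_pos_nonneg add_nonneg_pos)
  define \<alpha> where "\<alpha> = A powr (1 / r)"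
  define \<beta> where "\<beta> = B powr (1 / p)"
  have pos': "\<alpha> > 0" "\<beta> > 0" using pos by (auto simp: \<alpha>_def \<beta>_def)
  have [simp]: "\<alpha> powr r = A" "\<beta> powr p = B"
    using pos assms by (auto simp: \<alpha>_def \<beta>_def powr_powr)
  have Y: "(u / \<alpha>) * (v / \<beta>) \<le> (u powr r / A) / r + (v powr p / B) / p" if "u \<ge> 0" "v \<ge> 0" for u v
    using Youngs_inequality[of r p "u / \<alpha>" "v / \<beta>"] that assms pos' by (simp add: powr_divide)
  have "(a / \<alpha>) * (x / \<beta>) + (b / \<alpha>) * (y / \<beta>)
      \<le> (a powr r / A) / r + (x powr p / B) / p + ((b powr r / A) / r + (y powr p / B) / p)"
    using Y[of a x] Y[of b y] assms by linarith
  also have "\<dots> = ((a powr r + b powr r) / A) / r + ((x powr p + y powr p) / B) / p"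
    by (simp add: add_divide_distrib)
  also have "\<dots> = 1" using pos assms by (simp add: A_def B_def)
  finally have "(a * x + b * y) / (\<alpha> * \<beta>) \<le> 1"
    by (simp add: add_divide_distrib)
  thus ?thesis using pos' by (simp add: divide_le_eq \<alpha>_def \<beta>_def A_def B_def)
qed

text \<open>With \<open>x = m * (1 - a)\<close> and \<open>y = m * (1 + a)\<close> the noise merely
  replaces \<open>a\<close> by \<open>\<rho> * a\<close>, and homogeneity removes \<open>m\<close>.
  The power of two accounts for norms being sums and not averages.\<close>

lemma two_point_norm_le:
  fixes t \<delta> x y :: real
  defines "p \<equiv> 1 + t" and "q \<equiv> 1 + (1 - 2 * \<delta>)\<^sup>2 * t"
  assumes t: "0 < t" "t < 1" and \<delta>: "0 \<le> \<delta>" "\<delta> < 1 / 2" and xy: "x \<ge> 0" "y \<ge> 0"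
  shows "(((1 - \<delta>) * x + \<delta> * y) powr p + (\<delta> * x + (1 - \<delta>) * y) powr p) powr (1 / p)
    \<le> 2 powr (1 / p - 1 / q) * (x powr q + y powr q) powr (1 / q)"
  using xy
proof (induction x y rule: linorder_wlog)
  case (sym a b)
  thus ?case by (simp add: add.commute)
next
  case (le x y)
  show ?case
  proof (cases "y = 0")
    case True
    thus ?thesis using le by simp
  next
    case False
    define m where "m = (x + y) / 2"
    define a where "a = (y - x) / (x + y)"
    define \<rho> where "\<rho> = 1 - 2 * \<delta>"
    have m: "m > 0" using le False by (auto simp: m_def)
    have ma: "m * a = (y - x) / 2"
    proof -
      have "x + y \<noteq> 0" using le False by auto
      thus ?thesis by (simp add: m_def a_def divide_simps)
    qed
    have a: "0 \<le> a" "a \<le> 1" using le False by (auto simp: a_def divide_le_eq)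
    have \<rho>: "0 < \<rho>" "\<rho> \<le> 1" using \<delta> by (auto simp: \<rho>_def)
    have pq: "p > 1" "q > 1" using t \<rho> by (auto simp: p_def q_def \<rho>_def)
    have "\<rho> * a \<le> 1 * 1" using a \<rho> by (intro mult_mono) auto
    hence ra: "0 \<le> \<rho> * a" "\<rho> * a \<le> 1" using a \<rho> by auto
    have x: "x = m * (1 - a)" and y: "y = m * (1 + a)"
      using ma by (auto simp: algebra_simps m_def add_divide_distrib diff_divide_distrib)
    have X: "(1 - \<delta>) * x + \<delta> * y = m * (1 - \<rho> * a)"
      by (simp add: x y \<rho>_def algebra_simps)
    have Y: "\<delta> * x + (1 - \<delta>) * y = m * (1 + \<rho> * a)"
      by (simp add: x y \<rho>_def algebra_simps)
    define P where "P = ((1 + \<rho> * a) powr p + (1 - \<rho> * a) powr p) / 2"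
    define Q where "Q = ((1 + a) powr q + (1 - a) powr q) / 2"
    have PQ: "P \<ge> 0" "Q \<ge> 0" by (auto simp: P_def Q_def)
    have scale: "(m powr e * (2 * S)) powr (1 / e) = m * 2 powr (1 / e) * S powr (1 / e)"
      if "e > 1" "S \<ge> 0" for e S
    proof -
      have "(m powr e * (2 * S)) powr (1 / e) = (m powr e) powr (1 / e) * (2 powr (1 / e) * S powr (1 / e))"
        using that by (simp add: powr_mult del: powr_powr)
      thus ?thesis using that m by (simp add: powr_powr)
    qed
    have pm: "(m * z) powr e = m powr e * z powr e" if "z \<ge> 0" for z e
      using m that by (simp add: powr_mult)
    have pm': "(m * (1 - \<rho> * a)) powr p = m powr p * (1 - \<rho> * a) powr p"
      "(m * (1 + \<rho> * a)) powr p = m powr p * (1 + \<rho> * a) powr p"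
      "(m * (1 - a)) powr q = m powr q * (1 - a) powr q"
      "(m * (1 + a)) powr q = m powr q * (1 + a) powr q"
      by (rule pm; use a ra in simp)+
    have "((1 - \<delta>) * x + \<delta> * y) powr p + (\<delta> * x + (1 - \<delta>) * y) powr p
        = m powr p * (2 * P)"
      unfolding X Y P_def pm' by (simp add: distrib_left)
    hence "(((1 - \<delta>) * x + \<delta> * y) powr p + (\<delta> * x + (1 - \<delta>) * y) powr p) powr (1 / p)
       = m * 2 powr (1 / p) * P powr (1 / p)"
      using scale[OF pq(1) PQ(1)] by simp
    also have "\<dots> \<le> m * 2 powr (1 / p) * ((Q powr (p / q)) powr (1 / p))"
      using two_point_normalized[of t \<rho> a] t a \<rho> pq PQ m
      by (intro mult_left_mono powr_mono2) (auto simp: p_def q_def \<rho>_def P_def Q_def)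
    also have "(Q powr (p / q)) powr (1 / p) = Q powr (1 / q)" using pq by (simp add: powr_powr)
    also have "m * 2 powr (1 / p) * Q powr (1 / q) = 2 powr (1 / p - 1 / q) * (m * 2 powr (1 / q) * Q powr (1 / q))"
      by (simp add: powr_diff)
    also have "m * 2 powr (1 / q) * Q powr (1 / q) = (m powr q * (2 * Q)) powr (1 / q)"
      using scale[OF pq(2) PQ(2)] by simp
    also have "m powr q * (2 * Q) = x powr q + y powr q"
      unfolding x y Q_def pm' by (simp add: distrib_left)
    finally show ?thesis .
  qed
qed

text \<open>Since \<open>r\<close> is conjugate to \<open>1 + t\<close>, Holder's inequality
  dualises the norm bound. The bilinear form is the version that tensorises by induction over the
  coordinates.\<close>

lemma two_point_bilinear:
  fixes t \<delta> a b x y :: real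
  defines "r \<equiv> (1 + t) / t" and "q \<equiv> 1 + (1 - 2 * \<delta>)\<^sup>2 * t"
  assumes t: "0 < t" "t < 1" and \<delta>: "0 \<le> \<delta>" "\<delta> < 1 / 2"
    and nonneg: "a \<ge> 0" "b \<ge> 0" "x \<ge> 0" "y \<ge> 0"
  shows "(1 - \<delta>) * (a * x + b * y) + \<delta> * (a * y + b * x)
    \<le> 2 powr (1 - 1 / r - 1 / q) * (a powr r + b powr r) powr (1 / r) * (x powr q + y powr q) powr (1 / q)"
proof -
  define p where "p = 1 + t"
  have pr: "p > 1" "r > 1" using t by (auto simp: p_def r_def field_simps)
  have pr1: "1 / r + 1 / p = 1" using t by (simp add: p_def r_def field_simps)
  have "(1 - \<delta>) * (a * x + b * y) + \<delta> * (a * y + b * x)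
      = a * ((1 - \<delta>) * x + \<delta> * y) + b * (\<delta> * x + (1 - \<delta>) * y)"
    by (simp add: algebra_simps)
  also have "\<dots> \<le> (a powr r + b powr r) powr (1 / r)
      * (((1 - \<delta>) * x + \<delta> * y) powr p + (\<delta> * x + (1 - \<delta>) * y) powr p) powr (1 / p)"
    using pr pr1 nonneg \<delta> by (intro Holder_two) auto
  also have "\<dots> \<le> (a powr r + b powr r) powr (1 / r)
      * (2 powr (1 / p - 1 / q) * (x powr q + y powr q) powr (1 / q))"
    unfolding p_def q_def using assms by (intro mult_left_mono two_point_norm_le) auto
  also have "1 / p - 1 / q = 1 - 1 / r - 1 / q" using pr1 by simp
  finally show ?thesis by (simp add: mult_ac)
qed

section \<open>The noise kernel on the cube and its tensorised inequality\<close>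

abbreviation noise :: "real \<Rightarrow> int list \<Rightarrow> int list \<Rightarrow> real" where
  "noise \<delta> p q \<equiv> pmf (noise_pmf \<delta> p) q"

lemma cube_0 [simp]: "cube 0 = {[]}"
  by (auto simp: cube_def)

lemma cube_Suc: "cube (Suc d) = (#) 1 ` cube d \<union> (#) (-1) ` cube d"
  by (auto simp: cube_def length_Suc_conv)

lemma finite_cube [simp]: "finite (cube d)"
  by (induction d) (auto simp: cube_Suc)

lemma sum_cube_Suc: "(\<Sum>p\<in>cube (Suc d). f p) = (\<Sum>p\<in>cube d. f (1 # p)) + (\<Sum>p\<in>cube d. f (-1 # p))"
  unfolding cube_Suc by (subst sum.union_disjoint) (auto simp: sum.reindex)

lemma card_cube [simp]: "card (cube d) = 2 ^ d"
  using sum_cube_Suc[where f = "\<lambda>_. 1 :: nat"] by (induction d) auto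

lemma pmf_noise_Cons:
  assumes "0 \<le> \<delta>" "\<delta> \<le> 1" "a \<in> {-1, 1}" "b \<in> {-1, 1}"
  shows "noise \<delta> (a # p) (b # q) = (if a = b then 1 - \<delta> else \<delta>) * noise \<delta> p q"
proof -
  have inner: "pmf (bind_pmf (noise_pmf \<delta> p) (\<lambda>q. return_pmf (e # q))) (b # q)
    = (if e = b then noise \<delta> p q else 0)" for e
  proof -
    have "bind_pmf (noise_pmf \<delta> p) (\<lambda>q. return_pmf (e # q)) = map_pmf ((#) e) (noise_pmf \<delta> p)"
      by (simp add: map_pmf_def)
    moreover have "pmf (map_pmf ((#) e) (noise_pmf \<delta> p)) (b # q) = (if e = b then noise \<delta> p q else 0)"
    proof (cases "e = b")
      case True
      thus ?thesis by (simp add: pmf_map_inj')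
    next
      case False
      thus ?thesis by (auto simp: pmf_eq_0_set_pmf)
    qed
    ultimately show ?thesis by simp
  qed
  have neq: "- a \<noteq> a" using assms by auto
  show ?thesis
    unfolding noise_pmf.simps by (subst pmf_bind) (use assms in \<open>auto simp: inner\<close>)
qed

lemma noise_sym:
  assumes "0 \<le> \<delta>" "\<delta> \<le> 1" "p \<in> cube d" "q \<in> cube d"
  shows "noise \<delta> p q = noise \<delta> q p"
  using assms(3,4)
proof (induction d arbitrary: p q)
  case 0
  thus ?case by simp
next
  case (Suc d)
  then obtain a p' b q' where "p = a # p'" "q = b # q'" "p' \<in> cube d" "q' \<in> cube d"
    "a \<in> {-1, 1}" "b \<in> {-1, 1}"
    by (auto simp: cube_Suc)
  thus ?case using Suc.IH[of p' q'] assms(1,2) by (auto simp: pmf_noise_Cons simp del: noise_pmf.simps)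
qed

lemma set_noise_pmf:
  assumes "p \<in> cube d"
  shows "set_pmf (noise_pmf \<delta> p) \<subseteq> cube d"
  using assms
proof (induction d arbitrary: p)
  case 0
  thus ?case by simp
next
  case (Suc d)
  then obtain a p' where p: "p = a # p'" "p' \<in> cube d" "a \<in> {-1, 1}"
    by (auto simp: cube_Suc)
  have "set_pmf (noise_pmf \<delta> (a # p')) \<subseteq> (#) a ` cube d \<union> (#) (- a) ` cube d"
    using Suc.IH[OF p(2)] by (auto split: if_splits)
  also have "\<dots> = cube (Suc d)" using p(3) by (auto simp: cube_Suc)
  finally show ?case unfolding p(1) .
qed

lemma sum_noise_right: "p \<in> cube d \<Longrightarrow> (\<Sum>q\<in>cube d. noise \<delta> p q) = 1"
  by (rule sum_pmf_eq_1) (auto dest: set_noise_pmf)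

lemma sum_noise_left:
  assumes "0 \<le> \<delta>" "\<delta> \<le> 1" "q \<in> cube d"
  shows "(\<Sum>p\<in>cube d. noise \<delta> p q) = 1"
  using sum_noise_right[OF assms(3), of \<delta>] noise_sym[OF assms(1,2) _ assms(3)] by simp

text \<open>Splitting off the first coordinate leaves four forms of lower dimension. By induction
  each is at most a product of norms of half functions, and these four numbers are exactly the input
  of \<open>two_point_bilinear\<close>. The norms of the halves then recombine into the full
  norms.\<close>

theorem noise_bilinear:
  fixes t \<delta> :: real and f g :: "int list \<Rightarrow> real"
  defines "r \<equiv> (1 + t) / t" and "q \<equiv> 1 + (1 - 2 * \<delta>)\<^sup>2 * t"
  assumes t: "0 < t" "t < 1" and \<delta>: "0 \<le> \<delta>" "\<delta> < 1 / 2"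
    and nonneg: "\<And>x. f x \<ge> 0" "\<And>x. g x \<ge> 0"
  shows "(\<Sum>x\<in>cube d. \<Sum>y\<in>cube d. noise \<delta> x y * (f x * g y))
    \<le> (2 powr (1 - 1 / r - 1 / q)) ^ d * (\<Sum>x\<in>cube d. f x powr r) powr (1 / r)
        * (\<Sum>y\<in>cube d. g y powr q) powr (1 / q)"
  using nonneg
proof (induction d arbitrary: f g)
  case 0
  have "r > 0" "q > 0" using t by (simp_all add: r_def q_def add_pos_nonneg)
  thus ?case using 0 by (simp add: powr_powr)
next
  case (Suc d)
  define C where "C = 2 powr (1 - 1 / r - 1 / q)"
  define S where "S = (\<lambda>f g. \<Sum>x\<in>cube d. \<Sum>y\<in>cube d. noise \<delta> x y * (f x * g y) :: real)"
  define n\<^sub>f where "n\<^sub>f = (\<lambda>b :: int. (\<Sum>x\<in>cube d. f (b # x) powr r) powr (1 / r))"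
  define n\<^sub>g where "n\<^sub>g = (\<lambda>b :: int. (\<Sum>y\<in>cube d. g (b # y) powr q) powr (1 / q))"
  have rq: "r > 0" "q > 0" using t by (simp_all add: r_def q_def add_pos_nonneg)
  have IH: "S (\<lambda>x. f (a # x)) (\<lambda>y. g (b # y)) \<le> C ^ d * (n\<^sub>f a * n\<^sub>g b)" for a b
    using Suc.IH[of "\<lambda>x. f (a # x)" "\<lambda>y. g (b # y)"] Suc.prems by (simp add: S_def n\<^sub>f_def n\<^sub>g_def C_def mult_ac)
  have \<delta>': "0 \<le> \<delta>" "\<delta> \<le> 1" using \<delta> by auto
  have "(\<Sum>x\<in>cube (Suc d). \<Sum>y\<in>cube (Suc d). noise \<delta> x y * (f x * g y))
    = (1 - \<delta>) * (S (\<lambda>x. f (1 # x)) (\<lambda>y. g (1 # y)) + S (\<lambda>x. f (-1 # x)) (\<lambda>y. g (-1 # y)))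
      + \<delta> * (S (\<lambda>x. f (1 # x)) (\<lambda>y. g (-1 # y)) + S (\<lambda>x. f (-1 # x)) (\<lambda>y. g (1 # y)))"
    by (simp add: sum_cube_Suc pmf_noise_Cons[OF \<delta>'] S_def sum.distrib sum_distrib_left algebra_simps
        del: noise_pmf.simps)
  also have "\<dots> \<le> (1 - \<delta>) * (C ^ d * (n\<^sub>f 1 * n\<^sub>g 1) + C ^ d * (n\<^sub>f (-1) * n\<^sub>g (-1)))
      + \<delta> * (C ^ d * (n\<^sub>f 1 * n\<^sub>g (-1)) + C ^ d * (n\<^sub>f (-1) * n\<^sub>g 1))"
    using \<delta> by (intro add_mono mult_left_mono IH) auto
  also have "\<dots> = C ^ d * ((1 - \<delta>) * (n\<^sub>f 1 * n\<^sub>g 1 + n\<^sub>f (-1) * n\<^sub>g (-1))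
      + \<delta> * (n\<^sub>f 1 * n\<^sub>g (-1) + n\<^sub>f (-1) * n\<^sub>g 1))"
    by (simp add: algebra_simps)
  also have "\<dots> \<le> C ^ d * (C * (n\<^sub>f 1 powr r + n\<^sub>f (-1) powr r) powr (1 / r)
      * (n\<^sub>g 1 powr q + n\<^sub>g (-1) powr q) powr (1 / q))"
    unfolding C_def r_def q_def using t \<delta>
    by (intro mult_left_mono two_point_bilinear) (auto simp: n\<^sub>f_def n\<^sub>g_def)
  also have "n\<^sub>f 1 powr r + n\<^sub>f (-1) powr r = (\<Sum>x\<in>cube (Suc d). f x powr r)"
    using rq by (simp add: n\<^sub>f_def powr_powr sum_cube_Suc sum_nonneg)
  also have "n\<^sub>g 1 powr q + n\<^sub>g (-1) powr q = (\<Sum>x\<in>cube (Suc d). g x powr q)"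
    using rq by (simp add: n\<^sub>g_def powr_powr sum_cube_Suc sum_nonneg)
  finally show ?case by (simp add: C_def mult_ac)
qed

text \<open>The noised indicator \<open>v\<close> of \<open>A\<close> is tested against
  \<open>v powr t\<close>. As \<open>t * r = 1 + t\<close>, the moment \<open>V\<close> appears on
  both sides, on the right with exponent \<open>1 / r\<close>, and the inequality can be solved for
  \<open>V\<close>.\<close>

lemma noise_set_moment:
  fixes t \<delta> :: real
  assumes t: "0 < t" "t < 1" and \<delta>: "0 \<le> \<delta>" "\<delta> < 1 / 2" and A: "A \<subseteq> cube d"
  shows "(\<Sum>x\<in>cube d. (\<Sum>y\<in>A. noise \<delta> x y) powr (1 + t))
    \<le> 2 ^ d * (card A / 2 ^ d) powr ((1 + t) / (1 + (1 - 2 * \<delta>)\<^sup>2 * t))"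
proof -
  define p where "p = 1 + t"
  define r where "r = (1 + t) / t"
  define q where "q = 1 + (1 - 2 * \<delta>)\<^sup>2 * t"
  define v where "v = (\<lambda>x. \<Sum>y\<in>A. noise \<delta> x y)"
  define V where "V = (\<Sum>x\<in>cube d. v x powr p)"
  have [simp]: "finite A" by (rule finite_subset[OF A]) simp
  have v: "v x \<ge> 0" for x by (simp add: v_def sum_nonneg)
  have pq: "p > 1" "q > 0" using t by (simp_all add: p_def q_def add_pos_nonneg)
  have pr: "1 - 1 / r = 1 / p" "t * r = p" using t by (auto simp: p_def r_def field_simps)
  have V0: "V \<ge> 0" by (simp add: V_def sum_nonneg)
  show ?thesis
  proof (cases "V = 0")
    case True
    thus ?thesis by (simp add: V_def v_def p_def)
  next
    case False
    hence Vpos: "V > 0" using V0 by simp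
    have vp: "v x powr p = v x powr t * v x" for x
      using v[of x] by (cases "v x = 0") (auto simp: p_def powr_add)
    have "V = (\<Sum>x\<in>cube d. \<Sum>y\<in>cube d. noise \<delta> x y * (v x powr t * indicator A y))"
      unfolding V_def vp by (intro sum.cong) 
        (use A in \<open>auto simp: v_def sum_distrib_left sum_distrib_right mult_ac indicator_def if_distrib sum.If_cases Int_absorb1 cong: if_cong\<close>)
    also have "\<dots> \<le> (2 powr (1 - 1 / r - 1 / q)) ^ d * (\<Sum>x\<in>cube d. (v x powr t) powr r) powr (1 / r)
        * (\<Sum>y\<in>cube d. indicator A y powr q) powr (1 / q)"
      unfolding r_def q_def using t \<delta> by (intro noise_bilinear) auto
    also have "(\<Sum>x\<in>cube d. (v x powr t) powr r) = V" by (simp add: V_def powr_powr pr)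
    also have "(\<Sum>y\<in>cube d. indicator A y powr q) = card A"
    proof -
      have "(\<Sum>y\<in>cube d. indicator A y powr q) = (\<Sum>y\<in>cube d. indicator A y :: real)"
        using pq by (intro sum.cong) (auto simp: indicator_def)
      thus ?thesis using A by (simp add: indicator_def sum.If_cases Int_absorb1)
    qed
    also have "2 powr (1 - 1 / r - 1 / q) = 2 powr (1 / p - 1 / q)" using pr by simp
    finally have "V \<le> (2 powr (1 / p - 1 / q)) ^ d * V powr (1 / r) * card A powr (1 / q)" .
    hence "V / V powr (1 / r) \<le> (2 powr (1 / p - 1 / q)) ^ d * card A powr (1 / q)"
      using Vpos by (simp add: divide_le_eq mult_ac)
    also have "V / V powr (1 / r) = V powr (1 / p)"
      using Vpos by (simp add: pr(1)[symmetric] powr_diff)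
    finally have "(V powr (1 / p)) powr p \<le> ((2 powr (1 / p - 1 / q)) ^ d * card A powr (1 / q)) powr p"
      using pq by (intro powr_mono2) auto
    also have "(V powr (1 / p)) powr p = V" using Vpos pq by (simp add: powr_powr)
    also have "((2 powr (1 / p - 1 / q)) ^ d * card A powr (1 / q)) powr p
       = 2 powr (d - d * p / q) * card A powr (p / q)"
      using pq by (simp add: powr_mult powr_powr powr_realpow[symmetric] algebra_simps)
    also have "\<dots> = 2 ^ d * (card A / 2 ^ d) powr (p / q)"
      by (simp add: powr_divide powr_diff powr_realpow[symmetric] powr_powr)
    finally show ?thesis by (simp add: V_def v_def p_def q_def)
  qed
qed

section \<open>Trace bounds for reversible kernels\<close>

primrec kernel_power :: "'v set \<Rightarrow> ('v \<Rightarrow> 'v \<Rightarrow> real) \<Rightarrow> nat \<Rightarrow> 'v \<Rightarrow> 'v \<Rightarrow> real" where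
  "kernel_power V U 0 v u = (if v = u then 1 else 0)"
| "kernel_power V U (Suc k) v u = (\<Sum>z\<in>V. U v z * kernel_power V U k z u)"

text \<open>Detailed balance: \<open>U\<close> is self-adjoint in the inner product weighted by
  \<open>D\<close>, so the trace method applies without diagonalising \<open>U\<close>.\<close>

locale reversible_kernel =
  fixes V :: "'v set" and D :: "'v \<Rightarrow> real" and U :: "'v \<Rightarrow> 'v \<Rightarrow> real"
  assumes finite_V: "finite V"
    and D_pos: "v \<in> V \<Longrightarrow> D v > 0"
    and reversible: "v \<in> V \<Longrightarrow> u \<in> V \<Longrightarrow> D v * U v u = D u * U u v"
begin

lemma D_nz: "v \<in> V \<Longrightarrow> D v \<noteq> 0" and D_nn: "v \<in> V \<Longrightarrow> D v \<ge> 0"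
  using D_pos[of v] by auto

abbreviation "pow \<equiv> kernel_power V U"

text \<open>The quadratic form of the \<open>k\<close>-th power of \<open>U\<close> in the inner
  product weighted by \<open>D\<close>.\<close>

definition form :: "nat \<Rightarrow> ('v \<Rightarrow> real) \<Rightarrow> real" where
  "form k f = (\<Sum>v\<in>V. D v * f v * (\<Sum>u\<in>V. pow k v u * f u))"

lemma pow_add:
  assumes "v \<in> V"
  shows "pow (a + b) v u = (\<Sum>z\<in>V. pow a v z * pow b z u)"
  using assms
proof (induction a arbitrary: v)
  case 0
  have "(\<Sum>z\<in>V. pow 0 v z * pow b z u) = (\<Sum>z\<in>V. if z = v then pow b v u else 0)"
    by (intro sum.cong) auto
  thus ?case using 0 finite_V by simp
next
  case (Suc a)
  have "pow (Suc a + b) v u = (\<Sum>y\<in>V. U v y * (\<Sum>z\<in>V. pow a y z * pow b z u))"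
    using Suc.IH by simp
  also have "\<dots> = (\<Sum>z\<in>V. \<Sum>y\<in>V. U v y * (pow a y z * pow b z u))"
    by (subst sum.swap) (simp add: sum_distrib_left)
  also have "\<dots> = (\<Sum>z\<in>V. pow (Suc a) v z * pow b z u)"
    by (simp add: sum_distrib_left mult_ac)
  finally show ?case .
qed

lemma pow_1: "v \<in> V \<Longrightarrow> u \<in> V \<Longrightarrow> pow 1 v u = U v u"
  using finite_V by (simp add: if_distrib cong: if_cong)

lemma pow_reversible: "v \<in> V \<Longrightarrow> u \<in> V \<Longrightarrow> D v * pow k v u = D u * pow k u v"
proof (induction k arbitrary: v u)
  case 0
  thus ?case by simp
next
  case (Suc k)
  have "D v * pow (Suc k) v u = (\<Sum>z\<in>V. (D v * U v z) * pow k z u)"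
    by (simp add: sum_distrib_left mult_ac)
  also have "\<dots> = (\<Sum>z\<in>V. U z v * (D z * pow k z u))"
    using Suc.prems reversible by (intro sum.cong) (auto simp: mult_ac)
  also have "\<dots> = (\<Sum>z\<in>V. D u * (pow k u z * pow 1 z v))"
    using Suc by (intro sum.cong) (auto simp: pow_1 mult_ac simp del: kernel_power.simps One_nat_def)
  also have "\<dots> = D u * pow (k + 1) u v"
    using Suc.prems by (simp add: pow_add sum_distrib_left del: kernel_power.simps One_nat_def)
  finally show ?case by simp
qed

text \<open>Self-adjointness moves \<open>k\<close> of the factors to the other side, leaving a
  squared norm. In particular even powers have nonnegative forms.\<close>

lemma form_double: "form (k + k) f = (\<Sum>v\<in>V. D v * (\<Sum>u\<in>V. pow k v u * f u)\<^sup>2)"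
proof -
  have "(\<Sum>v\<in>V. D v * (\<Sum>u\<in>V. pow k v u * f u)\<^sup>2)
     = (\<Sum>v\<in>V. \<Sum>u\<in>V. \<Sum>z\<in>V. (D v * pow k v u) * pow k v z * (f u * f z))"
    by (simp add: power2_eq_square sum_distrib_left sum_distrib_right mult_ac)
  also have "\<dots> = (\<Sum>v\<in>V. \<Sum>u\<in>V. \<Sum>z\<in>V. D u * f u * (pow k u v * pow k v z) * f z)"
    by (intro sum.cong refl) (simp add: pow_reversible mult_ac)
  also have "\<dots> = (\<Sum>u\<in>V. \<Sum>z\<in>V. \<Sum>v\<in>V. D u * f u * (pow k u v * pow k v z) * f z)"
    by (rule trans[OF sum.swap], rule sum.cong[OF refl], rule sum.swap)
  also have "\<dots> = form (k + k) f"
    by (simp add: form_def pow_add sum_distrib_left sum_distrib_right mult_ac)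
  finally show ?thesis by simp
qed

text \<open>Cauchy-Schwarz for \<open>f\<close> and the \<open>k\<close>-th power of
  \<open>U\<close> applied to \<open>f\<close>, in the weighted inner product.\<close>

lemma form_square_le:
  assumes "(\<Sum>v\<in>V. D v * (f v)\<^sup>2) \<le> B"
  shows "(form k f)\<^sup>2 \<le> B * form (k + k) f"
proof -
  define g where "g = (\<lambda>v. \<Sum>u\<in>V. pow k v u * f u)"
  have "form k f = (\<Sum>v\<in>V. (sqrt (D v) * f v) * (sqrt (D v) * g v))"
  proof -
    have key: "(sqrt (D v) * f v) * (sqrt (D v) * g v) = D v * f v * g v" if "v \<in> V" for v
    proof -
      have "(sqrt (D v) * f v) * (sqrt (D v) * g v) = (sqrt (D v) * sqrt (D v)) * f v * g v"
        by (simp only: mult_ac)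
      thus ?thesis using that by (simp only: real_sqrt_mult_self abs_of_nonneg D_nn)
    qed
    have gv: "(\<Sum>u\<in>V. pow k v u * f u) = g v" for v by (simp add: g_def)
    show ?thesis
      unfolding form_def gv by (rule sum.cong[OF refl], rule key[symmetric])
  qed
  hence "(form k f)\<^sup>2 \<le> (\<Sum>v\<in>V. (sqrt (D v) * f v)\<^sup>2) * (\<Sum>v\<in>V. (sqrt (D v) * g v)\<^sup>2)"
    by (simp only: Cauchy_Schwarz_ineq_sum)
  also have "\<dots> = (\<Sum>v\<in>V. D v * (f v)\<^sup>2) * form (k + k) f"
    using D_pos by (simp add: form_double g_def power_mult_distrib less_imp_le cong: sum.cong)
  also have "\<dots> \<le> B * form (k + k) f"
    using assms D_pos by (intro mult_right_mono) (auto simp: form_double D_nn intro!: sum_nonneg mult_nonneg_nonneg)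
  finally show ?thesis .
qed

text \<open>Cauchy-Schwarz in every row bounds the operator norm of the \<open>k\<close>-th power by
  its Hilbert-Schmidt norm, and reversibility identifies the square of the latter with a
  trace.\<close>

lemma form_double_le_trace:
  assumes "(\<Sum>v\<in>V. D v * (f v)\<^sup>2) \<le> B"
  shows "form (k + k) f \<le> B * (\<Sum>v\<in>V. pow (k + k) v v)"
proof -
  have "(\<Sum>u\<in>V. pow k v u * f u)\<^sup>2 \<le> B * (\<Sum>u\<in>V. (pow k v u)\<^sup>2 / D u)" for v
  proof -
    have "(\<Sum>u\<in>V. pow k v u * f u) = (\<Sum>u\<in>V. (pow k v u / sqrt (D u)) * (sqrt (D u) * f u))"
      by (intro sum.cong) (auto simp: D_nz)
    hence "(\<Sum>u\<in>V. pow k v u * f u)\<^sup>2 \<le> (\<Sum>u\<in>V. (pow k v u / sqrt (D u))\<^sup>2) * (\<Sum>u\<in>V. (sqrt (D u) * f u)\<^sup>2)"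
      by (simp only: Cauchy_Schwarz_ineq_sum)
    also have "\<dots> = (\<Sum>u\<in>V. (pow k v u)\<^sup>2 / D u) * (\<Sum>v\<in>V. D v * (f v)\<^sup>2)"
      using D_pos by (simp add: power_mult_distrib power_divide less_imp_le cong: sum.cong)
    also have "\<dots> \<le> (\<Sum>u\<in>V. (pow k v u)\<^sup>2 / D u) * B"
      using assms D_pos by (intro mult_left_mono) (auto simp: D_nn intro!: sum_nonneg divide_nonneg_nonneg)
    finally show ?thesis by (simp add: mult_ac)
  qed
  hence "form (k + k) f \<le> (\<Sum>v\<in>V. D v * (B * (\<Sum>u\<in>V. (pow k v u)\<^sup>2 / D u)))"
    unfolding form_double using D_pos by (intro sum_mono mult_left_mono) (auto simp: D_nn)
  also have "\<dots> = B * (\<Sum>v\<in>V. \<Sum>u\<in>V. (D v * pow k v u) * pow k v u / D u)"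
    by (simp add: sum_distrib_left power2_eq_square mult_ac)
  also have "(\<Sum>v\<in>V. \<Sum>u\<in>V. (D v * pow k v u) * pow k v u / D u) = (\<Sum>v\<in>V. \<Sum>u\<in>V. pow k v u * pow k u v)"
  proof (intro sum.cong refl)
    fix v u
    assume "v \<in> V" "u \<in> V"
    thus "D v * pow k v u * pow k v u / D u = pow k v u * pow k u v"
      using pow_reversible[of v u k] D_nz[of u] by simp
  qed
  also have "\<dots> = (\<Sum>v\<in>V. pow (k + k) v v)"
    by (intro sum.cong refl) (simp add: pow_add)
  finally show ?thesis .
qed

text \<open>Each application of \<open>form_square_le\<close> doubles the power of the kernel, which
  is why only powers of two occur as exponents.\<close>

lemma abs_form_power_le:
  assumes "(\<Sum>v\<in>V. D v * (f v)\<^sup>2) \<le> B"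
  shows "\<bar>form 1 f\<bar> ^ (2 ^ j) \<le> B ^ (2 ^ j - 1) * \<bar>form (2 ^ j) f\<bar>"
proof (induction j)
  case 0
  thus ?case by simp
next
  case (Suc j)
  have B: "B \<ge> 0"
    using assms D_pos by (intro order_trans[OF _ assms] sum_nonneg mult_nonneg_nonneg) (auto simp: D_nn)
  have "(2 :: nat) ^ j \<ge> 1" by simp
  hence e: "(2 :: nat) ^ Suc j - 1 = (2 ^ j - 1) * 2 + 1"
    unfolding power_Suc by linarith
  have "\<bar>form 1 f\<bar> ^ (2 ^ Suc j) = (\<bar>form 1 f\<bar> ^ (2 ^ j))\<^sup>2"
    by (simp add: power_mult[symmetric] mult.commute)
  also have "\<dots> \<le> (B ^ (2 ^ j - 1) * \<bar>form (2 ^ j) f\<bar>)\<^sup>2"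
    using Suc.IH by (intro power_mono) auto
  also have "\<dots> = B ^ ((2 ^ j - 1) * 2) * (form (2 ^ j) f)\<^sup>2"
    by (simp add: power_mult_distrib power_mult)
  also have "\<dots> \<le> B ^ ((2 ^ j - 1) * 2) * (B * form (2 ^ j + 2 ^ j) f)"
    using B assms by (intro mult_left_mono form_square_le) auto
  also have "\<dots> = B ^ (2 ^ Suc j - 1) * form (2 ^ Suc j) f"
    unfolding e by (simp add: mult_2 mult_ac)
  also have "\<dots> \<le> B ^ (2 ^ Suc j - 1) * \<bar>form (2 ^ Suc j) f\<bar>"
    using B by (intro mult_left_mono) auto
  finally show ?case .
qed

theorem form_power_le_trace:
  assumes f: "\<And>v. v \<in> V \<Longrightarrow> \<bar>f v\<bar> \<le> 1" and B: "(\<Sum>v\<in>V. D v) \<le> B" and M: "M = 2 ^ Suc j"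
  shows "\<bar>\<Sum>v\<in>V. \<Sum>u\<in>V. D v * U v u * f v * f u\<bar> ^ M \<le> B ^ M * (\<Sum>v\<in>V. pow M v v)"
proof -
  have "(\<Sum>v\<in>V. D v * (f v)\<^sup>2) \<le> (\<Sum>v\<in>V. D v * 1)"
    using f D_pos by (intro sum_mono mult_left_mono) (auto simp: abs_square_le_1 less_imp_le)
  hence fB: "(\<Sum>v\<in>V. D v * (f v)\<^sup>2) \<le> B" using B by simp
  have B0: "B \<ge> 0" using D_pos by (intro order_trans[OF _ B] sum_nonneg) (auto simp: D_nn)
  have M2: "M = 2 ^ j + 2 ^ j" using M by simp
  have nn: "form M f \<ge> 0" unfolding M2 form_double 
    by (intro sum_nonneg mult_nonneg_nonneg) (auto simp: D_nn)
  have "(\<Sum>v\<in>V. \<Sum>u\<in>V. D v * U v u * f v * f u) = form 1 f"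
    by (simp add: form_def pow_1 sum_distrib_left mult_ac del: kernel_power.simps One_nat_def cong: sum.cong)
  \<comment> \<open>The doubling chain costs \<open>M - 1\<close> factors \<open>B\<close>; the
    passage to the trace costs the last one.\<close>
  hence "\<bar>\<Sum>v\<in>V. \<Sum>u\<in>V. D v * U v u * f v * f u\<bar> ^ M \<le> B ^ (M - 1) * form M f"
    using abs_form_power_le[OF fB, of "Suc j"] nn unfolding M by simp
  also have "\<dots> \<le> B ^ (M - 1) * (B * (\<Sum>v\<in>V. pow M v v))"
    using B0 form_double_le_trace[OF fB, of "2 ^ j"] unfolding M2 by (intro mult_left_mono) auto
  also have "\<dots> = B ^ M * (\<Sum>v\<in>V. pow M v v)"
  proof -
    have "M \<noteq> 0" using M by simp
    thus ?thesis by (simp add: power_eq_if[of B M])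
  qed
  finally show ?thesis .
qed

end

section \<open>Signed random walks\<close>

definition tuples :: "'a set \<Rightarrow> nat \<Rightarrow> 'a list set" where
  "tuples X n = {xs. length xs = n \<and> set xs \<subseteq> X}"

lemma finite_tuples [simp]: "finite X \<Longrightarrow> finite (tuples X n)"
  using finite_lists_length_eq[of X n] by (simp add: tuples_def conj_commute)

lemma card_tuples: "finite X \<Longrightarrow> card (tuples X n) = card X ^ n"
  using card_lists_length_eq[of X n] by (simp add: tuples_def conj_commute)

lemma tuples_0 [simp]: "tuples X 0 = {[]}"
  by (auto simp: tuples_def)

lemma sum_tuples_Suc: "(\<Sum>xs\<in>tuples X (Suc n). f xs) = (\<Sum>x\<in>X. \<Sum>xs\<in>tuples X n. f (x # xs))"
  unfolding sum.cartesian_product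
  by (rule sum.reindex_bij_witness[of _ "\<lambda>(x, xs). x # xs" "\<lambda>xs. (hd xs, tl xs)"])
    (auto simp: tuples_def length_Suc_conv)

lemma update_in_tuples: "xs \<in> tuples X n \<Longrightarrow> y \<in> X \<Longrightarrow> xs[i := y] \<in> tuples X n"
  using set_update_subset_insert[of xs i y] by (auto simp: tuples_def)

lemma nth_in_tuples: "xs \<in> tuples X n \<Longrightarrow> i < n \<Longrightarrow> xs ! i \<in> X"
  by (auto simp: tuples_def)

text \<open>Exchanging coordinate \<open>i\<close> with the separately summed \<open>y\<close> is an
  involution on pairs, and \<open>g\<close> does not see it. This is independence of coordinate
  \<open>i\<close> from a function that ignores it, stated with sums.\<close>

lemma sum_tuples_indep:
  fixes g :: "'a list \<Rightarrow> real"
  assumes i: "i < n" and g: "\<And>xs y. xs \<in> tuples X n \<Longrightarrow> y \<in> X \<Longrightarrow> g (xs[i := y]) = g xs"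
  shows "card X * (\<Sum>xs\<in>tuples X n. g xs * h (xs ! i)) = (\<Sum>xs\<in>tuples X n. g xs) * (\<Sum>y\<in>X. h y)"
proof -
  have "(\<Sum>xs\<in>tuples X n. g xs) * (\<Sum>y\<in>X. h y) = (\<Sum>(xs, y)\<in>tuples X n \<times> X. g xs * h y)"
    by (simp add: sum_product sum.cartesian_product)
  also have "\<dots> = (\<Sum>(xs, y)\<in>tuples X n \<times> X. g xs * h (xs ! i))"
    by (rule sum.reindex_bij_witness[of _ "\<lambda>(xs, y). (xs[i := y], xs ! i)" "\<lambda>(xs, y). (xs[i := y], xs ! i)"])
      (use i g in \<open>auto simp: update_in_tuples nth_in_tuples\<close>, auto simp: tuples_def)
  also have "\<dots> = card X * (\<Sum>xs\<in>tuples X n. g xs * h (xs ! i))"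
    by (simp flip: sum.cartesian_product add: sum_distrib_left)
  finally show ?thesis by simp
qed

section \<open>Products of random signs\<close>

definition sgn_bit :: "bool \<Rightarrow> real" where
  "sgn_bit b = (if b then -1 else 1)"

definition sgn_prod :: "bool list \<Rightarrow> nat list \<Rightarrow> real" where
  "sgn_prod x is = (\<Prod>i\<leftarrow>is. sgn_bit (x ! i))"

lemma sgn_prod_Nil [simp]: "sgn_prod x [] = 1"
  and sgn_prod_Cons [simp]: "sgn_prod x (i # is) = sgn_bit (x ! i) * sgn_prod x is"
  by (simp_all add: sgn_prod_def)

lemma abs_sgn_bit [simp]: "\<bar>sgn_bit b\<bar> = 1"
  by (simp add: sgn_bit_def)

lemma abs_sgn_prod [simp]: "\<bar>sgn_prod x is\<bar> = 1"
  by (induction "is") (auto simp: abs_mult)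

lemma sgn_prod_flip:
  "i < length x \<Longrightarrow> sgn_prod (x[i := \<not> x ! i]) is = (-1) ^ count_list is i * sgn_prod x is"
proof (induction "is")
  case (Cons j "is")
  thus ?case by (cases "j = i") (auto simp: sgn_bit_def)
qed simp

text \<open>\<open>S\<close> holds the indices already seen. The value is \<open>l\<close> to the
  power of repetitions minus first occurrences, a multiplicative surrogate for the condition that
  repetitions are at least as frequent, and it can be summed one index at a time.\<close>

primrec sign_weight :: "real \<Rightarrow> nat set \<Rightarrow> nat list \<Rightarrow> real" where
  "sign_weight l S [] = 1"
| "sign_weight l S (i # is) = (if i \<in> S then l else 1 / l) * sign_weight l (insert i S) is"

text \<open>The cardinality counts first occurrences. The closed form is multiplied out so that no
  negative exponent is needed.\<close>

lemma sign_weight_eq: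
  assumes "l \<noteq> 0"
  shows "sign_weight l S is * l ^ (2 * card (set is - S)) = l ^ length is"
proof (induction "is" arbitrary: S)
  case (Cons i "is")
  show ?case
  proof (cases "i \<in> S")
    case True
    hence "set (i # is) - S = set is - S" "insert i S = S" by auto
    thus ?thesis using Cons[of S] True by (simp add: mult_ac)
  next
    case False
    hence "set (i # is) - S = insert i (set is - insert i S)" by auto
    hence "card (set (i # is) - S) = Suc (card (set is - insert i S))" by simp
    thus ?thesis using Cons[of "insert i S"] False assms by (simp add: field_simps)
  qed
qed simp

text \<open>Averaging over the signs kills every index sequence in which some index occurs exactly
  once; in the remaining ones at least half of the positions are repetitions.\<close>

lemma sum_sgn_prod_le:
  assumes "l \<ge> 1" "set is \<subseteq> {..<n}"
  shows "\<bar>\<Sum>x\<in>tuples UNIV n. sgn_prod x is\<bar> \<le> 2 ^ n * sign_weight l {} is"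
proof (cases "\<exists>i\<in>set is. count_list is i = 1")
  case True
  then obtain i where i: "i \<in> set is" "count_list is i = 1" by blast
  hence "i < n" using assms by auto
  \<comment> \<open>Flipping bit \<open>i\<close> permutes the sign vectors and negates each
    product, so the sum equals its own negative.\<close>
  have "(\<Sum>x\<in>tuples UNIV n. sgn_prod x is) = (\<Sum>x\<in>tuples UNIV n. sgn_prod (x[i := \<not> x ! i]) is)"
    by (rule sum.reindex_bij_witness[of _ "\<lambda>x. x[i := \<not> x ! i]" "\<lambda>x. x[i := \<not> x ! i]"])
      (use \<open>i < n\<close> in \<open>auto simp: tuples_def\<close>)
  also have "\<dots> = (\<Sum>x\<in>tuples UNIV n. - sgn_prod x is)"
    using \<open>i < n\<close> i by (intro sum.cong) (auto simp: sgn_prod_flip tuples_def)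
  finally have "(\<Sum>x\<in>tuples UNIV n. sgn_prod x is) = 0" by (simp add: sum_negf)
  moreover have "sign_weight l S is \<ge> 0" for S
    using assms(1) by (induction "is" arbitrary: S) auto
  ultimately show ?thesis by simp
next
  case False
  have "card (set is) * 2 = (\<Sum>i\<in>set is. 2)" by simp
  also have "\<dots> \<le> (\<Sum>i\<in>set is. count_list is i)"
  proof (rule sum_mono)
    fix i assume i: "i \<in> set is"
    hence "count_list is i \<noteq> 0" by (simp add: count_list_0_iff)
    moreover have "count_list is i \<noteq> 1" using False i by blast
    ultimately show "2 \<le> count_list is i" by linarith
  qed
  also have "\<dots> = length is" by (simp add: sum_count_set)
  finally have le: "2 * card (set is) \<le> length is" by simp
  have "l ^ (2 * card (set is)) \<le> sign_weight l {} is * l ^ (2 * card (set is))"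
    using sign_weight_eq[of l "{}" "is"] assms(1) le power_increasing[OF le assms(1)] by simp
  hence "sign_weight l {} is \<ge> 1" using assms(1) by simp
  moreover have "\<bar>\<Sum>x\<in>tuples UNIV n. sgn_prod x is\<bar> \<le> (\<Sum>x\<in>tuples (UNIV :: bool set) n. \<bar>sgn_prod x is\<bar>)"
    by (rule sum_abs)
  moreover have "\<dots> = 2 ^ n" by (simp add: card_tuples)
  ultimately show ?thesis by (smt (verit) mult_le_cancel_left1 zero_less_power)
qed

text \<open>Two row bounds are kept apart: \<open>row_le\<close> holds for every data point and is
  charged when a walk repeats an index, while \<open>row_avg\<close> holds on average over a uniform
  point and is charged at a new index.\<close>

locale random_kernel =
  fixes V :: "'v set" and X :: "'p set" and L :: real and D :: "'v \<Rightarrow> real"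
    and H :: "'p \<Rightarrow> 'v \<Rightarrow> 'v \<Rightarrow> real"
  assumes fin_V: "finite V" and fin_X: "finite X" and X_ne: "X \<noteq> {}" and L_pos: "L > 0"
    and weight_pos: "v \<in> V \<Longrightarrow> D v > 0"
    and H_sym: "p \<in> X \<Longrightarrow> v \<in> V \<Longrightarrow> u \<in> V \<Longrightarrow> H p v u = H p u v"
    and row_le: "p \<in> X \<Longrightarrow> v \<in> V \<Longrightarrow> (\<Sum>u\<in>V. \<bar>H p v u\<bar>) \<le> L * D v"
    and row_avg: "v \<in> V \<Longrightarrow> (\<Sum>p\<in>X. \<Sum>u\<in>V. \<bar>H p v u\<bar>) \<le> card X * D v"
begin

definition step :: "'p \<Rightarrow> 'v \<Rightarrow> 'v \<Rightarrow> real" where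
  "step p v u = \<bar>H p v u\<bar> / D v"

primrec walk :: "'p list \<Rightarrow> nat list \<Rightarrow> 'v \<Rightarrow> real" where
  "walk P [] v = 1"
| "walk P (i # is) v = (\<Sum>u\<in>V. step (P ! i) v u * walk P is u)"

primrec signed_walk :: "'p list \<Rightarrow> nat list \<Rightarrow> 'v \<Rightarrow> 'v \<Rightarrow> real" where
  "signed_walk P [] v z = (if v = z then 1 else 0)"
| "signed_walk P (i # is) v z = (\<Sum>u\<in>V. H (P ! i) v u / D v * signed_walk P is u z)"

primrec walk_bound :: "nat set \<Rightarrow> nat list \<Rightarrow> real" where
  "walk_bound S [] = 1"
| "walk_bound S (i # is) = (if i \<in> S then L else 1) * walk_bound (insert i S) is"

lemma step_nonneg: "v \<in> V \<Longrightarrow> step p v u \<ge> 0"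
  using weight_pos[of v] by (simp add: step_def)

lemma walk_bound_nonneg: "walk_bound S is \<ge> 0"
  using L_pos by (induction "is" arbitrary: S) auto

text \<open>Taking absolute values also frees the endpoint \<open>z\<close>. A bound for each
  starting vertex remains, which later gives the factor \<open>card V\<close> in the trace.\<close>

lemma abs_signed_walk_le: "v \<in> V \<Longrightarrow> \<bar>signed_walk P is v z\<bar> \<le> walk P is v"
proof (induction "is" arbitrary: v)
  case (Cons i "is")
  have "\<bar>signed_walk P (i # is) v z\<bar> \<le> (\<Sum>u\<in>V. \<bar>H (P ! i) v u / D v * signed_walk P is u z\<bar>)"
    unfolding signed_walk.simps by (rule sum_abs)
  also have "\<dots> = (\<Sum>u\<in>V. step (P ! i) v u * \<bar>signed_walk P is u z\<bar>)"
    using weight_pos[OF Cons.prems] by (simp add: step_def abs_mult)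
  also have "\<dots> \<le> (\<Sum>u\<in>V. step (P ! i) v u * walk P is u)"
    using Cons.IH step_nonneg[OF Cons.prems] by (intro sum_mono mult_left_mono) auto
  finally show ?case by simp
qed auto

text \<open>The set \<open>S\<close> holds the indices that occurred before. A step at a new index is averaged over
  its data point; a step at an old index costs the pointwise bound \<open>L\<close>.\<close>

lemma sum_walk_le:
  assumes "set is \<subseteq> {..<n}" "v \<in> V" "\<And>P. P \<in> tuples X n \<Longrightarrow> g P \<ge> 0"
    and "\<And>P i y. P \<in> tuples X n \<Longrightarrow> i \<notin> S \<Longrightarrow> y \<in> X \<Longrightarrow> g (P[i := y]) = g P"
  shows "(\<Sum>P\<in>tuples X n. g P * walk P is v) \<le> (\<Sum>P\<in>tuples X n. g P) * walk_bound S is"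
  using assms
proof (induction "is" arbitrary: v g S)
  case Nil
  thus ?case by simp
next
  case (Cons i "is")
  have i: "i < n" using Cons.prems(1) by simp
  define h where "h = (\<lambda>p. \<Sum>u\<in>V. step p v u)"
  have h_le: "h p \<le> L" if "p \<in> X" for p
    using row_le[OF that Cons.prems(2)] weight_pos[OF Cons.prems(2)]
    by (simp add: h_def step_def divide_le_eq flip: sum_divide_distrib)
  have h_avg: "(\<Sum>p\<in>X. h p) \<le> card X"
    using row_avg[OF Cons.prems(2)] weight_pos[OF Cons.prems(2)]
    by (simp add: h_def step_def divide_le_eq flip: sum_divide_distrib)
  \<comment> \<open>The step just taken joins the prefactor, which may now also depend on point
    \<open>i\<close>; hence the set grows to \<open>insert i S\<close>.\<close>
  have IH: "(\<Sum>P\<in>tuples X n. (g P * step (P ! i) v u) * walk P is u)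
      \<le> (\<Sum>P\<in>tuples X n. g P * step (P ! i) v u) * walk_bound (insert i S) is" if "u \<in> V" for u
  proof (rule Cons.IH)
    show "set is \<subseteq> {..<n}" using Cons.prems(1) by simp
    show "u \<in> V" by fact
    show "g P * step (P ! i) v u \<ge> 0" if "P \<in> tuples X n" for P
      using Cons.prems(2,3) that by (simp add: step_nonneg)
    show "g (P[j := y]) * step (P[j := y] ! i) v u = g P * step (P ! i) v u"
      if "P \<in> tuples X n" "j \<notin> insert i S" "y \<in> X" for P j y
      using Cons.prems(4)[of P j y] that by auto
  qed
  have "(\<Sum>P\<in>tuples X n. g P * walk P (i # is) v)
     = (\<Sum>u\<in>V. \<Sum>P\<in>tuples X n. (g P * step (P ! i) v u) * walk P is u)"
    by (subst sum.swap) (simp add: sum_distrib_left mult_ac)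
  also have "\<dots> \<le> (\<Sum>u\<in>V. (\<Sum>P\<in>tuples X n. g P * step (P ! i) v u) * walk_bound (insert i S) is)"
    by (intro sum_mono IH)
  also have "\<dots> = (\<Sum>P\<in>tuples X n. g P * h (P ! i)) * walk_bound (insert i S) is"
    unfolding sum_distrib_right[symmetric] by (subst sum.swap) (simp add: h_def sum_distrib_left)
  also have "\<dots> \<le> ((\<Sum>P\<in>tuples X n. g P) * (if i \<in> S then L else 1)) * walk_bound (insert i S) is"
  proof (rule mult_right_mono)
    show "(\<Sum>P\<in>tuples X n. g P * h (P ! i)) \<le> (\<Sum>P\<in>tuples X n. g P) * (if i \<in> S then L else 1)"
    proof (cases "i \<in> S")
      case True
      have "(\<Sum>P\<in>tuples X n. g P * h (P ! i)) \<le> (\<Sum>P\<in>tuples X n. g P * L)"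
        using Cons.prems(3) h_le i by (intro sum_mono mult_left_mono) (auto simp: nth_in_tuples)
      thus ?thesis using True by (simp add: sum_distrib_right)
    next
      case False
      have "card X * (\<Sum>P\<in>tuples X n. g P * h (P ! i)) = (\<Sum>P\<in>tuples X n. g P) * (\<Sum>p\<in>X. h p)"
        using Cons.prems(4) False by (intro sum_tuples_indep i) auto
      also have "\<dots> \<le> (\<Sum>P\<in>tuples X n. g P) * card X"
        using Cons.prems(3) by (intro mult_left_mono h_avg sum_nonneg) auto
      finally show ?thesis using False X_ne fin_X by (simp add: mult_ac card_gt_0_iff)
    qed
  qed (rule walk_bound_nonneg)
  finally show ?case by (simp add: mult_ac)
qed

text \<open>Indices are chosen one after another. At most \<open>n\<close> new ones contribute
  \<open>1 / l\<close> each, and at most \<open>M\<close> old ones contribute \<open>L * l\<close>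
  each.\<close>

lemma sum_weights_le:
  assumes "l > 0" "finite S" "card S + k \<le> M"
  shows "(\<Sum>is\<in>tuples {..<n} k. sign_weight l S is * walk_bound S is) \<le> (n / l + M * L * l) ^ k"
  using assms(2,3)
proof (induction k arbitrary: S)
  case 0
  thus ?case by simp
next
  case (Suc k)
  define K where "K = n / l + M * L * l"
  have K: "K \<ge> 0" using assms(1) L_pos by (simp add: K_def)
  define w where "w = (\<lambda>i. if i \<in> S then l * L else 1 / l)"
  have w: "w i \<ge> 0" for i using assms(1) L_pos by (simp add: w_def)
  have IH: "(\<Sum>is\<in>tuples {..<n} k. sign_weight l (insert i S) is * walk_bound (insert i S) is) \<le> K ^ k" for i
    unfolding K_def using Suc.prems by (intro Suc.IH) (auto simp: card_insert_if)
  have "(\<Sum>is\<in>tuples {..<n} (Suc k). sign_weight l S is * walk_bound S is)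
    = (\<Sum>i<n. w i * (\<Sum>is\<in>tuples {..<n} k. sign_weight l (insert i S) is * walk_bound (insert i S) is))"
    unfolding sum_tuples_Suc by (intro sum.cong refl) (auto simp: w_def sum_distrib_left mult_ac)
  also have "\<dots> \<le> (\<Sum>i<n. w i * K ^ k)"
    by (intro sum_mono mult_left_mono IH w)
  also have "\<dots> = (\<Sum>i<n. w i) * K ^ k" by (simp add: sum_distrib_right)
  also have "(\<Sum>i<n. w i) \<le> K"
  proof -
    have "(\<Sum>i<n. w i) \<le> (\<Sum>i<n. 1 / l + indicator S i * (l * L))"
      using assms(1) L_pos by (intro sum_mono) (auto simp: w_def)
    also have "\<dots> = n / l + card ({..<n} \<inter> S) * (l * L)"
      by (simp add: sum.distrib sum_distrib_right[symmetric] indicator_def sum.If_cases)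
    also have "\<dots> \<le> n / l + M * (l * L)"
    proof -
      have "card ({..<n} \<inter> S) \<le> card S" using Suc.prems by (intro card_mono) auto
      also have "\<dots> \<le> M" using Suc.prems by simp
      finally show ?thesis using assms(1) L_pos by (intro add_left_mono mult_right_mono) auto
    qed
    finally show ?thesis by (simp add: K_def mult_ac)
  qed
  hence "(\<Sum>i<n. w i) * K ^ k \<le> K * K ^ k" using K by (intro mult_right_mono) auto
  finally show ?case by (simp add: K_def)
qed

text \<open>Division by \<open>D v\<close> turns the symmetric signed matrix into a kernel
  reversible with respect to \<open>D\<close>.\<close>

definition kernel :: "nat \<Rightarrow> bool list \<Rightarrow> 'p list \<Rightarrow> 'v \<Rightarrow> 'v \<Rightarrow> real" where
  "kernel n x P v u = (\<Sum>i<n. sgn_bit (x ! i) * H (P ! i) v u) / D v"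

lemma kernel_power_expand:
  "kernel_power V (kernel n x P) k v u = (\<Sum>is\<in>tuples {..<n} k. sgn_prod x is * signed_walk P is v u)"
proof (induction k arbitrary: v)
  case 0
  thus ?case by simp
next
  case (Suc k)
  have k: "kernel n x P v z = (\<Sum>i<n. sgn_bit (x ! i) * (H (P ! i) v z / D v))" for z
    by (simp add: kernel_def sum_divide_distrib)
  have "kernel_power V (kernel n x P) (Suc k) v u
    = (\<Sum>z\<in>V. \<Sum>i<n. \<Sum>is\<in>tuples {..<n} k.
        (sgn_bit (x ! i) * sgn_prod x is) * (H (P ! i) v z / D v * signed_walk P is z u))"
    by (simp add: Suc.IH k sum_product mult_ac)
  also have "\<dots> = (\<Sum>i<n. \<Sum>is\<in>tuples {..<n} k. \<Sum>z\<in>V.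
        (sgn_bit (x ! i) * sgn_prod x is) * (H (P ! i) v z / D v * signed_walk P is z u))"
    by (rule trans[OF sum.swap], rule sum.cong[OF refl], rule sum.swap)
  also have "\<dots> = (\<Sum>is\<in>tuples {..<n} (Suc k). sgn_prod x is * signed_walk P is v u)"
    by (simp add: sum_tuples_Suc sum_distrib_left)
  finally show ?case .
qed

text \<open>For a fixed index sequence the sums over signs and over data points factor. The first is
  controlled by \<open>sum_sgn_prod_le\<close>, the second by \<open>sum_walk_le\<close>, and the
  product of the two weights is summed by \<open>sum_weights_le\<close>.\<close>

lemma sum_trace_le:
  assumes l: "l \<ge> 1"
  shows "(\<Sum>x\<in>tuples UNIV n. \<Sum>P\<in>tuples X n. \<Sum>v\<in>V. kernel_power V (kernel n x P) M v v)
    \<le> 2 ^ n * card X ^ n * card V * (n / l + M * L * l) ^ M"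
proof -
  have pt: "\<bar>\<Sum>P\<in>tuples X n. signed_walk P is v v\<bar> \<le> card X ^ n * walk_bound {} is"
    if "v \<in> V" "is \<in> tuples {..<n} M" for v "is"
  proof -
    have "\<bar>\<Sum>P\<in>tuples X n. signed_walk P is v v\<bar> \<le> (\<Sum>P\<in>tuples X n. 1 * walk P is v)"
      using that abs_signed_walk_le by (intro order_trans[OF sum_abs] sum_mono) auto
    also have "\<dots> \<le> (\<Sum>P\<in>tuples X n. 1) * walk_bound {} is"
      using that by (intro sum_walk_le) (auto simp: tuples_def)
    finally show ?thesis by (simp add: card_tuples fin_X)
  qed
  have "(\<Sum>x\<in>tuples UNIV n. \<Sum>P\<in>tuples X n. \<Sum>v\<in>V. kernel_power V (kernel n x P) M v v)
    = (\<Sum>x\<in>tuples UNIV n. \<Sum>P\<in>tuples X n. \<Sum>v\<in>V. \<Sum>is\<in>tuples {..<n} M. sgn_prod x is * signed_walk P is v v)"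
    by (simp add: kernel_power_expand)
  also have "\<dots> = (\<Sum>x\<in>tuples UNIV n. \<Sum>v\<in>V. \<Sum>P\<in>tuples X n. \<Sum>is\<in>tuples {..<n} M. sgn_prod x is * signed_walk P is v v)"
    by (intro sum.cong refl sum.swap)
  also have "\<dots> = (\<Sum>v\<in>V. \<Sum>x\<in>tuples UNIV n. \<Sum>is\<in>tuples {..<n} M. \<Sum>P\<in>tuples X n. sgn_prod x is * signed_walk P is v v)"
    by (rule trans[OF sum.swap]) (intro sum.cong refl sum.swap)
  also have "\<dots> = (\<Sum>v\<in>V. \<Sum>is\<in>tuples {..<n} M. \<Sum>x\<in>tuples UNIV n. \<Sum>P\<in>tuples X n. sgn_prod x is * signed_walk P is v v)"
    by (intro sum.cong refl sum.swap)
  also have "\<dots> = (\<Sum>v\<in>V. \<Sum>is\<in>tuples {..<n} M.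
      (\<Sum>x\<in>tuples UNIV n. sgn_prod x is) * (\<Sum>P\<in>tuples X n. signed_walk P is v v))"
    by (simp add: sum_product)
  also have "\<dots> \<le> (\<Sum>v\<in>V. \<Sum>is\<in>tuples {..<n} M. (2 ^ n * sign_weight l {} is) * (card X ^ n * walk_bound {} is))"
  proof (intro sum_mono)
    fix v "is" assume v: "v \<in> V" and "is": "is \<in> tuples {..<n} M"
    have s: "\<bar>\<Sum>x\<in>tuples UNIV n. sgn_prod x is\<bar> \<le> 2 ^ n * sign_weight l {} is"
      using "is" by (intro sum_sgn_prod_le l) (simp add: tuples_def)
    have "(\<Sum>x\<in>tuples UNIV n. sgn_prod x is) * (\<Sum>P\<in>tuples X n. signed_walk P is v v)
      \<le> \<bar>\<Sum>x\<in>tuples UNIV n. sgn_prod x is\<bar> * \<bar>\<Sum>P\<in>tuples X n. signed_walk P is v v\<bar>"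
      by (metis abs_ge_self abs_mult)
    also have "\<dots> \<le> (2 ^ n * sign_weight l {} is) * (card X ^ n * walk_bound {} is)"
      using s pt[OF v "is"] by (intro mult_mono) (auto intro: order_trans[OF abs_ge_zero])
    finally show "(\<Sum>x\<in>tuples UNIV n. sgn_prod x is) * (\<Sum>P\<in>tuples X n. signed_walk P is v v)
      \<le> (2 ^ n * sign_weight l {} is) * (card X ^ n * walk_bound {} is)" .
  qed
  also have "\<dots> = 2 ^ n * card X ^ n * card V * (\<Sum>is\<in>tuples {..<n} M. sign_weight l {} is * walk_bound {} is)"
    by (simp add: sum_distrib_left mult_ac)
  also have "\<dots> \<le> 2 ^ n * card X ^ n * card V * (n / l + M * L * l) ^ M"
    using l by (intro mult_left_mono sum_weights_le) auto
  finally show ?thesis .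
qed

text \<open>The test vector \<open>F x P\<close> may depend on signs and points, because the trace
  dominates all bounded test vectors at once. This is what admits a table computed from the
  data.\<close>

theorem sum_form_power_le:
  fixes F :: "bool list \<Rightarrow> 'p list \<Rightarrow> 'v \<Rightarrow> real"
  assumes l: "l \<ge> 1" and M: "M = 2 ^ Suc j" and B: "(\<Sum>v\<in>V. D v) \<le> B" "B \<ge> 0"
    and F: "\<And>x P v. v \<in> V \<Longrightarrow> \<bar>F x P v\<bar> \<le> 1"
  shows "(\<Sum>x\<in>tuples UNIV n. \<Sum>P\<in>tuples X n.
      \<bar>\<Sum>i<n. sgn_bit (x ! i) * (\<Sum>v\<in>V. \<Sum>u\<in>V. H (P ! i) v u * F x P v * F x P u)\<bar> ^ M)
    \<le> 2 ^ n * card X ^ n * card V * (B * (n / l + M * L * l)) ^ M"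
proof -
  have "\<bar>\<Sum>i<n. sgn_bit (x ! i) * (\<Sum>v\<in>V. \<Sum>u\<in>V. H (P ! i) v u * F x P v * F x P u)\<bar> ^ M
     \<le> B ^ M * (\<Sum>v\<in>V. kernel_power V (kernel n x P) M v v)"
    if P: "P \<in> tuples X n" for x P
  proof -
    interpret reversible_kernel V D "kernel n x P"
    proof
      fix v u assume vu: "v \<in> V" "u \<in> V"
      have "(\<Sum>i<n. sgn_bit (x ! i) * H (P ! i) v u) = (\<Sum>i<n. sgn_bit (x ! i) * H (P ! i) u v)"
        using P vu by (intro sum.cong refl) (simp add: H_sym nth_in_tuples)
      thus "D v * kernel n x P v u = D u * kernel n x P u v"
        using weight_pos[of v] weight_pos[of u] vu by (simp add: kernel_def)
    qed (use fin_V weight_pos in auto)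
    have "(\<Sum>i<n. sgn_bit (x ! i) * (\<Sum>v\<in>V. \<Sum>u\<in>V. H (P ! i) v u * F x P v * F x P u))
      = (\<Sum>v\<in>V. \<Sum>u\<in>V. \<Sum>i<n. sgn_bit (x ! i) * (H (P ! i) v u * F x P v * F x P u))"
      unfolding sum_distrib_left by (rule trans[OF sum.swap], rule sum.cong[OF refl], rule sum.swap)
    also have "\<dots> = (\<Sum>v\<in>V. \<Sum>u\<in>V. D v * kernel n x P v u * F x P v * F x P u)"
      by (intro sum.cong refl) (use weight_pos in \<open>auto simp: kernel_def D_nz sum_distrib_right mult.assoc\<close>)
    finally show ?thesis
      using form_power_le_trace[OF F B(1) M] by simp
  qed
  hence "(\<Sum>x\<in>tuples UNIV n. \<Sum>P\<in>tuples X n.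
      \<bar>\<Sum>i<n. sgn_bit (x ! i) * (\<Sum>v\<in>V. \<Sum>u\<in>V. H (P ! i) v u * F x P v * F x P u)\<bar> ^ M)
    \<le> (\<Sum>x\<in>tuples UNIV n. \<Sum>P\<in>tuples X n. B ^ M * (\<Sum>v\<in>V. kernel_power V (kernel n x P) M v v))"
    by (intro sum_mono)
  also have "\<dots> = B ^ M * (\<Sum>x\<in>tuples UNIV n. \<Sum>P\<in>tuples X n. \<Sum>v\<in>V. kernel_power V (kernel n x P) M v v)"
    by (simp add: sum_distrib_left)
  also have "\<dots> \<le> B ^ M * (2 ^ n * card X ^ n * card V * (n / l + M * L * l) ^ M)"
    using B(2) by (intro mult_left_mono sum_trace_le l) auto
  finally show ?thesis by (simp add: power_mult_distrib mult_ac)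
qed

end

section \<open>Truncation of the query distribution\<close>

definition vol :: "nat \<Rightarrow> (int list \<Rightarrow> 'v) \<Rightarrow> 'v \<Rightarrow> real" where
  "vol d e v = card {q \<in> cube d. e q = v} / 2 ^ d"

definition hit :: "nat \<Rightarrow> real \<Rightarrow> (int list \<Rightarrow> 'v) \<Rightarrow> int list \<Rightarrow> 'v \<Rightarrow> real" where
  "hit d \<delta> e p v = (\<Sum>q\<in>{q \<in> cube d. e q = v}. noise \<delta> p q)"

text \<open>By Bayes, \<open>hit / vol\<close> is the density at \<open>p\<close>, relative to the
  uniform law, of the planted point given that the query falls into the cell
  \<open>v\<close>.\<close>

definition light :: "nat \<Rightarrow> real \<Rightarrow> real \<Rightarrow> (int list \<Rightarrow> 'v) \<Rightarrow> int list \<Rightarrow> 'v \<Rightarrow> bool" where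
  "light d \<delta> L e p v \<longleftrightarrow> hit d \<delta> e p v \<le> L * vol d e v"

lemma hit_nonneg: "hit d \<delta> e p v \<ge> 0"
  by (simp add: hit_def sum_nonneg)

lemma vol_nonneg: "vol d e v \<ge> 0"
  by (simp add: vol_def)

lemma vol_le_1: "vol d e v \<le> 1"
proof -
  have "card {q \<in> cube d. e q = v} \<le> card (cube d)" by (intro card_mono) auto
  hence "real (card {q \<in> cube d. e q = v}) \<le> 2 ^ d" by simp
  thus ?thesis by (simp add: vol_def)
qed

lemma vol_pos: "q \<in> cube d \<Longrightarrow> vol d e (e q) > 0"
  unfolding vol_def by (intro divide_pos_pos) (auto simp: card_gt_0_iff)

lemma sum_vol:
  assumes "e ` cube d \<subseteq> V" "finite V"
  shows "(\<Sum>v\<in>V. vol d e v) = 1"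
proof -
  have "(\<Sum>v\<in>V. \<Sum>q\<in>{q \<in> cube d. e q = v}. 1 :: real) = (\<Sum>q\<in>cube d. 1)"
    by (rule sum.group) (use assms in auto)
  thus ?thesis by (simp add: vol_def flip: sum_divide_distrib)
qed

text \<open>A query planted at a uniform point is itself uniform, by symmetry of the noise.\<close>

lemma sum_hit:
  assumes "0 \<le> \<delta>" "\<delta> \<le> 1"
  shows "(\<Sum>p\<in>cube d. hit d \<delta> e p v) = 2 ^ d * vol d e v"
proof -
  have "(\<Sum>p\<in>cube d. hit d \<delta> e p v) = (\<Sum>q\<in>{q \<in> cube d. e q = v}. \<Sum>p\<in>cube d. noise \<delta> p q)"
    unfolding hit_def by (rule sum.swap)
  also have "\<dots> = (\<Sum>q\<in>{q \<in> cube d. e q = v}. 1)"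
    using assms by (intro sum.cong) (auto simp: sum_noise_left)
  finally show ?thesis by (simp add: vol_def)
qed

text \<open>Hypercontractivity with the exponents \<open>1 + t\<close> and \<open>1 + \<rho>\<^sup>2 * t\<close>, followed by Markov's
  inequality for the \<open>t\<close>-th power; cells of volume below \<open>\<theta>\<close> are charged to the first term.\<close>

lemma sum_heavy_cell_le:
  assumes t: "0 < t" "t < 1" and \<delta>: "0 < \<delta>" "\<delta> < 1 / 2" and L: "L > 0" and \<theta>: "0 < \<theta>" "\<theta> \<le> 1"
  defines "\<kappa> \<equiv> (L * \<theta> powr ((1 + t) * (1 - 2 * \<delta>)\<^sup>2)) powr (-t)"
  shows "(\<Sum>p\<in>cube d. if light d \<delta> L e p v then 0 else hit d \<delta> e p v)
    \<le> 2 ^ d * (\<theta> + vol d e v * \<kappa>)"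
proof (cases "vol d e v < \<theta>")
  case True
  have "(\<Sum>p\<in>cube d. if light d \<delta> L e p v then 0 else hit d \<delta> e p v) \<le> (\<Sum>p\<in>cube d. hit d \<delta> e p v)"
    by (intro sum_mono) (auto simp: hit_nonneg)
  also have "\<dots> = 2 ^ d * vol d e v" using \<delta> by (simp add: sum_hit)
  also have "\<dots> \<le> 2 ^ d * (\<theta> + vol d e v * \<kappa>)"
    using True by (intro mult_left_mono) (auto simp: \<kappa>_def vol_nonneg add_increasing2)
  finally show ?thesis .
next
  case False
  define \<mu> where "\<mu> = vol d e v"
  define r where "r = (1 - 2 * \<delta>)\<^sup>2"
  have \<mu>: "0 < \<mu>" "\<theta> \<le> \<mu>" "\<mu> \<le> 1" using False \<theta> by (auto simp: \<mu>_def vol_le_1)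
  have r: "r \<ge> 0" by (simp add: r_def)
  have "(\<Sum>p\<in>cube d. if light d \<delta> L e p v then 0 else hit d \<delta> e p v)
    \<le> (\<Sum>p\<in>cube d. hit d \<delta> e p v powr (1 + t) * (L * \<mu>) powr (-t))"
  proof (rule sum_mono)
    fix p
    show "(if light d \<delta> L e p v then 0 else hit d \<delta> e p v) \<le> hit d \<delta> e p v powr (1 + t) * (L * \<mu>) powr (-t)"
    proof (cases "light d \<delta> L e p v")
      case True
      thus ?thesis by simp
    next
      case False
      hence h: "hit d \<delta> e p v > L * \<mu>" by (simp add: light_def \<mu>_def)
      have p: "L * \<mu> > 0" using L \<mu> by simp
      have "(L * \<mu>) powr t \<le> hit d \<delta> e p v powr t" using h p t by (intro powr_mono2) auto
      hence "hit d \<delta> e p v * (L * \<mu>) powr t \<le> hit d \<delta> e p v * hit d \<delta> e p v powr t"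
        by (intro mult_left_mono) (auto simp: hit_nonneg)
      moreover have "hit d \<delta> e p v powr (1 + t) = hit d \<delta> e p v * hit d \<delta> e p v powr t"
        using h p by (simp add: powr_add)
      moreover have X: "(L * \<mu>) powr t > 0" using L \<mu> by simp
      ultimately show ?thesis using False by (simp add: powr_minus_divide pos_le_divide_eq[OF X])
    qed
  qed
  also have "\<dots> = (\<Sum>p\<in>cube d. hit d \<delta> e p v powr (1 + t)) * (L * \<mu>) powr (-t)"
    by (simp add: sum_distrib_right)
  also have "\<dots> \<le> (2 ^ d * \<mu> powr ((1 + t) / (1 + r * t))) * (L * \<mu>) powr (-t)"
    using noise_set_moment[OF t, of \<delta> "{q \<in> cube d. e q = v}" d] \<delta>
    by (intro mult_right_mono) (auto simp: hit_def \<mu>_def vol_def r_def)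
  also have "\<dots> = 2 ^ d * (\<mu> * (L powr (-t) * \<mu> powr ((1 + t) / (1 + r * t) - 1 - t)))"
    using \<mu> L by (simp add: powr_mult powr_diff powr_minus powr_add field_simps)
  \<comment> \<open>Dropping the denominator \<open>1 + r * t\<close>, which is at least one, makes
    the exponent more negative, and \<mu> \<le> 1 makes the power larger. Then \<mu> is replaced by
    the smaller \<theta>.\<close>
  also have "\<dots> \<le> 2 ^ d * (\<mu> * (L powr (-t) * \<theta> powr (- ((1 + t) * r * t))))"
  proof -
    have rt: "1 + r * t > 0" "r * t \<ge> 0" using r t by (auto simp: add_pos_nonneg)
    have e: "(1 + t) / (1 + r * t) - 1 - t = - ((1 + t) * r * t) / (1 + r * t)"
      using rt by (simp add: field_simps)
    have "(1 + t) * r * t \<ge> 0" using r t by simp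
    hence "(1 + t) * r * t * 1 \<le> (1 + t) * r * t * (1 + r * t)"
      using rt by (intro mult_left_mono) auto
    hence "(1 + t) * r * t / (1 + r * t) \<le> (1 + t) * r * t"
      unfolding pos_divide_le_eq[OF rt(1)] by simp
    hence "\<mu> powr ((1 + t) / (1 + r * t) - 1 - t) \<le> \<mu> powr (- ((1 + t) * r * t))"
      unfolding e using \<mu> by (intro powr_mono') auto
    also have "\<dots> \<le> \<theta> powr (- ((1 + t) * r * t))"
      using \<mu> \<theta> r t by (intro powr_mono2') auto
    finally show ?thesis using \<mu> by (intro mult_left_mono) auto
  qed
  also have "L powr (-t) * \<theta> powr (- ((1 + t) * r * t)) = \<kappa>"
    using L \<theta> by (simp add: \<kappa>_def r_def powr_mult powr_powr)
  also have "2 ^ d * (\<mu> * \<kappa>) \<le> 2 ^ d * (\<theta> + \<mu> * \<kappa>)"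
    using \<theta> by simp
  finally show ?thesis by (simp add: \<mu>_def)
qed

text \<open>Summing over cells, the term \<theta> is paid once per cell, hence at most
  \<open>s\<close> times. The term \<kappa> is paid in proportion to volume, hence once in
  total.\<close>

lemma sum_heavy_le:
  assumes t: "0 < t" "t < 1" and \<delta>: "0 < \<delta>" "\<delta> < 1 / 2" and L: "L > 0" and \<theta>: "0 < \<theta>" "\<theta> \<le> 1"
    and s: "card (e ` cube d) \<le> s"
  defines "\<kappa> \<equiv> (L * \<theta> powr ((1 + t) * (1 - 2 * \<delta>)\<^sup>2)) powr (-t)"
  shows "(\<Sum>p\<in>cube d. \<Sum>q\<in>cube d. if light d \<delta> L e p (e q) then 0 else noise \<delta> p q)
    \<le> 2 ^ d * (s * \<theta> + \<kappa>)"
proof -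
  have "(\<Sum>p\<in>cube d. \<Sum>q\<in>cube d. if light d \<delta> L e p (e q) then 0 else noise \<delta> p q)
    = (\<Sum>p\<in>cube d. \<Sum>v\<in>e ` cube d. if light d \<delta> L e p v then 0 else hit d \<delta> e p v)"
    by (intro sum.cong refl, subst sum.image_gen[where g = e], simp) (auto simp: hit_def intro!: sum.cong)
  also have "\<dots> = (\<Sum>v\<in>e ` cube d. \<Sum>p\<in>cube d. if light d \<delta> L e p v then 0 else hit d \<delta> e p v)"
    by (rule sum.swap)
  also have "\<dots> \<le> (\<Sum>v\<in>e ` cube d. 2 ^ d * (\<theta> + vol d e v * \<kappa>))"
    unfolding \<kappa>_def using assms by (intro sum_mono sum_heavy_cell_le) auto
  also have "\<dots> = 2 ^ d * (card (e ` cube d) * \<theta> + (\<Sum>v\<in>e ` cube d. vol d e v) * \<kappa>)"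
    by (simp add: sum_distrib_left[symmetric] sum.distrib sum_distrib_right[symmetric])
  also have "\<dots> = 2 ^ d * (card (e ` cube d) * \<theta> + \<kappa>)"
    by (simp add: sum_vol)
  also have "\<dots> \<le> 2 ^ d * (s * \<theta> + \<kappa>)"
    using s \<theta> by (intro mult_left_mono add_right_mono mult_right_mono) auto
  finally show ?thesis .
qed

section \<open>The truncated matrix joining the two probed cells\<close>

definition light_noise :: "nat \<Rightarrow> real \<Rightarrow> real \<Rightarrow> (int list \<Rightarrow> 'v) \<Rightarrow> (int list \<Rightarrow> 'v) \<Rightarrow> int list \<Rightarrow> int list \<Rightarrow> real" where
  "light_noise d \<delta> L e e' p q = (if light d \<delta> L e p (e q) \<and> light d \<delta> L e' p (e' q) then noise \<delta> p q else 0)"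

text \<open>Each query is a weighted edge between the cells it probes. Both orientations are added
  to make the matrix symmetric, which doubles the associated form.\<close>

definition edge_matrix ::
  "nat \<Rightarrow> real \<Rightarrow> real \<Rightarrow> (int list \<Rightarrow> 'v) \<Rightarrow> (int list \<Rightarrow> 'v) \<Rightarrow> (int list \<Rightarrow> real) \<Rightarrow> int list \<Rightarrow> 'v \<Rightarrow> 'v \<Rightarrow> real" where
  "edge_matrix d \<delta> L e e' \<tau> p v u = (\<Sum>q\<in>cube d. light_noise d \<delta> L e e' p q * \<tau> q
     * (of_bool (e q = v \<and> e' q = u) + of_bool (e' q = v \<and> e q = u)))"

lemma light_noise_nonneg: "light_noise d \<delta> L e e' p q \<ge> 0"
  and light_noise_le: "light_noise d \<delta> L e e' p q \<le> noise \<delta> p q"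
  by (simp_all add: light_noise_def)

lemma light_noise_swap: "light_noise d \<delta> L e' e = light_noise d \<delta> L e e'"
  by (auto simp: light_noise_def fun_eq_iff)

lemma sum_light_noise_le:
  assumes "L \<ge> 0"
  shows "(\<Sum>q\<in>cube d. light_noise d \<delta> L e e' p q * of_bool (e q = v)) \<le> L * vol d e v"
proof -
  have "(\<Sum>q\<in>cube d. light_noise d \<delta> L e e' p q * of_bool (e q = v))
    \<le> (\<Sum>q\<in>cube d. if e q = v then (if light d \<delta> L e p v then noise \<delta> p q else 0) else 0)"
    by (intro sum_mono) (auto simp: light_noise_def)
  also have "\<dots> = (if light d \<delta> L e p v then hit d \<delta> e p v else 0)"
    by (simp add: hit_def sum.If_cases Int_def)
  also have "\<dots> \<le> L * vol d e v"
    using assms vol_nonneg[of d e v] by (auto simp: light_def)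
  finally show ?thesis .
qed

text \<open>A query meeting \<open>v\<close> through one probe has a single partner cell, so summing
  over \<open>u\<close> leaves at most one term per orientation.\<close>

lemma sum_edge_matrix_row:
  assumes \<tau>: "\<And>q. \<bar>\<tau> q\<bar> \<le> 1" and V: "finite V"
  shows "(\<Sum>u\<in>V. \<bar>edge_matrix d \<delta> L e e' \<tau> p v u\<bar>)
    \<le> (\<Sum>q\<in>cube d. light_noise d \<delta> L e e' p q * of_bool (e q = v))
      + (\<Sum>q\<in>cube d. light_noise d \<delta> L e e' p q * of_bool (e' q = v))"
proof -
  have "(\<Sum>u\<in>V. \<bar>edge_matrix d \<delta> L e e' \<tau> p v u\<bar>)
    \<le> (\<Sum>u\<in>V. \<Sum>q\<in>cube d. light_noise d \<delta> L e e' p q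
          * (of_bool (e q = v) * of_bool (e' q = u) + of_bool (e' q = v) * of_bool (e q = u)))"
    unfolding edge_matrix_def
  proof (rule sum_mono, rule order_trans[OF sum_abs], rule sum_mono)
    fix u q
    have "\<bar>light_noise d \<delta> L e e' p q * \<tau> q * (of_bool (e q = v \<and> e' q = u) + of_bool (e' q = v \<and> e q = u))\<bar>
      = light_noise d \<delta> L e e' p q * (\<bar>\<tau> q\<bar> * (of_bool (e q = v) * of_bool (e' q = u) + of_bool (e' q = v) * of_bool (e q = u)))"
      by (simp add: abs_mult light_noise_nonneg of_bool_conj mult_ac)
    also have "\<dots> \<le> light_noise d \<delta> L e e' p q * (of_bool (e q = v) * of_bool (e' q = u) + of_bool (e' q = v) * of_bool (e q = u))"
      using \<tau> by (intro mult_left_mono mult_left_le_one_le) (auto simp: light_noise_nonneg)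
    finally show "\<bar>light_noise d \<delta> L e e' p q * \<tau> q * (of_bool (e q = v \<and> e' q = u) + of_bool (e' q = v \<and> e q = u))\<bar>
      \<le> light_noise d \<delta> L e e' p q * (of_bool (e q = v) * of_bool (e' q = u) + of_bool (e' q = v) * of_bool (e q = u))" .
  qed
  also have "\<dots> = (\<Sum>q\<in>cube d. light_noise d \<delta> L e e' p q
      * (of_bool (e q = v) * (\<Sum>u\<in>V. of_bool (e' q = u)) + of_bool (e' q = v) * (\<Sum>u\<in>V. of_bool (e q = u))))"
    by (subst sum.swap) (simp only: sum_distrib_left[symmetric] sum.distrib)
  also have "\<dots> \<le> (\<Sum>q\<in>cube d. light_noise d \<delta> L e e' p q * (of_bool (e q = v) * 1 + of_bool (e' q = v) * 1))"
  proof (intro sum_mono mult_left_mono add_mono)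
    have "(\<Sum>u\<in>V. of_bool (z = u) :: real) \<le> 1" for z
      using V by (simp add: of_bool_def)
    thus "(\<Sum>u\<in>V. of_bool (e' q = u) :: real) \<le> 1" "(\<Sum>u\<in>V. of_bool (e q = u) :: real) \<le> 1" for q
      by auto
  qed (auto simp: light_noise_nonneg)
  finally show ?thesis by (simp add: distrib_left sum.distrib)
qed

lemma edge_matrix_form:
  assumes V: "finite V" "e ` cube d \<subseteq> V" "e' ` cube d \<subseteq> V"
  shows "(\<Sum>v\<in>V. \<Sum>u\<in>V. edge_matrix d \<delta> L e e' \<tau> p v u * f v * f u)
    = 2 * (\<Sum>q\<in>cube d. light_noise d \<delta> L e e' p q * \<tau> q * f (e q) * f (e' q))"
proof -
  have key: "(\<Sum>v\<in>V. \<Sum>u\<in>V. of_bool (a = v \<and> b = u) * (f v * f u)) = f a * f b" if "a \<in> V" "b \<in> V" for a b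
  proof -
    have "(\<Sum>v\<in>V. \<Sum>u\<in>V. of_bool (a = v \<and> b = u) * (f v * f u))
      = (\<Sum>v\<in>V. (if a = v then f v else 0) * (\<Sum>u\<in>V. if b = u then f u else 0))"
      by (auto simp: sum_distrib_left intro!: sum.cong)
    thus ?thesis using that V by (simp flip: sum_distrib_right)
  qed
  have "(\<Sum>v\<in>V. \<Sum>u\<in>V. edge_matrix d \<delta> L e e' \<tau> p v u * f v * f u)
    = (\<Sum>v\<in>V. \<Sum>u\<in>V. \<Sum>q\<in>cube d. (light_noise d \<delta> L e e' p q * \<tau> q)
        * (of_bool (e q = v \<and> e' q = u) * (f v * f u) + of_bool (e' q = v \<and> e q = u) * (f v * f u)))"
    unfolding edge_matrix_def sum_distrib_right by (intro sum.cong refl) (simp only: algebra_simps)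
  also have "\<dots> = (\<Sum>q\<in>cube d. \<Sum>v\<in>V. \<Sum>u\<in>V. (light_noise d \<delta> L e e' p q * \<tau> q)
        * (of_bool (e q = v \<and> e' q = u) * (f v * f u) + of_bool (e' q = v \<and> e q = u) * (f v * f u)))"
    by (rule trans[OF sum.cong[OF refl sum.swap] sum.swap])
  also have "\<dots> = (\<Sum>q\<in>cube d. (light_noise d \<delta> L e e' p q * \<tau> q)
        * ((\<Sum>v\<in>V. \<Sum>u\<in>V. of_bool (e q = v \<and> e' q = u) * (f v * f u))
          + (\<Sum>v\<in>V. \<Sum>u\<in>V. of_bool (e' q = v \<and> e q = u) * (f v * f u))))"
    by (simp only: sum_distrib_left[symmetric] sum.distrib)
  also have "\<dots> = (\<Sum>q\<in>cube d. 2 * (light_noise d \<delta> L e e' p q * \<tau> q * f (e q) * f (e' q)))"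
  proof (rule sum.cong[OF refl])
    fix q assume "q \<in> cube d"
    hence "e q \<in> V" "e' q \<in> V" using V by auto
    thus "(light_noise d \<delta> L e e' p q * \<tau> q)
        * ((\<Sum>v\<in>V. \<Sum>u\<in>V. of_bool (e q = v \<and> e' q = u) * (f v * f u))
          + (\<Sum>v\<in>V. \<Sum>u\<in>V. of_bool (e' q = v \<and> e q = u) * (f v * f u)))
      = 2 * (light_noise d \<delta> L e e' p q * \<tau> q * f (e q) * f (e' q))"
      by (simp only: key) simp
  qed
  finally show ?thesis by (simp add: sum_distrib_left)
qed

text \<open>The vertices are the cells that some query reaches, so that all weights are positive.
  Truncation supplies \<open>row_le\<close>, and the uniform law of the query supplies
  \<open>row_avg\<close>.\<close>

lemma random_kernel_edge_matrix:
  fixes e e' :: "int list \<Rightarrow> 'v"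
  assumes \<tau>: "\<And>q. \<bar>\<tau> q\<bar> \<le> 1" and L: "L > 0" and \<delta>: "0 \<le> \<delta>" "\<delta> \<le> 1"
  shows "random_kernel (e ` cube d \<union> e' ` cube d) (cube d) L (\<lambda>v. vol d e v + vol d e' v)
    (edge_matrix d \<delta> L e e' \<tau>)"
proof
  let ?V = "e ` cube d \<union> e' ` cube d"
  show fin: "finite ?V" by simp
  show "finite (cube d)" by simp
  show "cube d \<noteq> {}" using card_cube[of d] by (metis card.empty power_eq_0_iff zero_neq_numeral)
  show "L > 0" by fact
  show "vol d e v + vol d e' v > 0" if "v \<in> ?V" for v
  proof -
    have "vol d e v > 0 \<or> vol d e' v > 0"
      using that by (auto simp: vol_pos)
    thus ?thesis using vol_nonneg[of d e v] vol_nonneg[of d e' v] by linarith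
  qed
  show "edge_matrix d \<delta> L e e' \<tau> p v u = edge_matrix d \<delta> L e e' \<tau> p u v" for p v u
    unfolding edge_matrix_def by (intro sum.cong refl) (auto simp: conj_commute add.commute)
  show "(\<Sum>u\<in>?V. \<bar>edge_matrix d \<delta> L e e' \<tau> p v u\<bar>) \<le> L * (vol d e v + vol d e' v)" for p v
    using sum_edge_matrix_row[where \<tau> = \<tau>, OF \<tau> fin, where d = d and \<delta> = \<delta> and L = L and e = e and e' = e' and p = p and v = v]
      sum_light_noise_le[where d = d and \<delta> = \<delta> and L = L and e = e and e' = e' and p = p and v = v]
      sum_light_noise_le[where d = d and \<delta> = \<delta> and L = L and e = e' and e' = e and p = p and v = v] L
    by (simp add: light_noise_swap[of d \<delta> L e e'] distrib_left)
  have hit_ge: "(\<Sum>q\<in>cube d. light_noise d \<delta> L e e' p q * of_bool (f q = v)) \<le> hit d \<delta> f p v"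
    for f :: "int list \<Rightarrow> 'v" and p v
  proof -
    have "(\<Sum>q\<in>cube d. light_noise d \<delta> L e e' p q * of_bool (f q = v))
      \<le> (\<Sum>q\<in>cube d. if f q = v then noise \<delta> p q else 0)"
      by (intro sum_mono) (auto simp: light_noise_le)
    thus ?thesis by (simp add: hit_def sum.If_cases Int_def)
  qed
  show "(\<Sum>p\<in>cube d. \<Sum>u\<in>?V. \<bar>edge_matrix d \<delta> L e e' \<tau> p v u\<bar>) \<le> card (cube d) * (vol d e v + vol d e' v)" for v
  proof -
    have "(\<Sum>p\<in>cube d. \<Sum>u\<in>?V. \<bar>edge_matrix d \<delta> L e e' \<tau> p v u\<bar>)
      \<le> (\<Sum>p\<in>cube d. hit d \<delta> e p v + hit d \<delta> e' p v)"
      by (intro sum_mono order_trans[OF sum_edge_matrix_row[where \<tau> = \<tau>, OF \<tau> fin]] add_mono hit_ge)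
    thus ?thesis using \<delta> by (simp add: sum.distrib sum_hit distrib_left)
  qed
qed

section \<open>From moments of the form to the mean correlation\<close>

lemma sum_tuples_nth:
  fixes h :: "'a \<Rightarrow> real"
  assumes "i < n"
  shows "card X * (\<Sum>P\<in>tuples X n. h (P ! i)) = card (tuples X n) * (\<Sum>p\<in>X. h p)"
  using sum_tuples_indep[OF assms, of X "\<lambda>_. 1" h] by simp

text \<open>The threshold \<open>y\<close> separates small values from those dominated by their
  \<open>M\<close>-th power, so an \<open>M\<close>-th moment bound yields a bound on the
  mean.\<close>

lemma le_add_power_div:
  fixes a y :: real
  assumes "y > 0" "M \<ge> 1" "a \<ge> 0"
  shows "a \<le> y + y * (a / y) ^ M"
proof (cases "a \<le> y")
  case True
  thus ?thesis using assms by (simp add: add_increasing2)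
next
  case False
  hence "(a / y) ^ 1 \<le> (a / y) ^ M" using assms by (intro power_increasing) auto
  hence "y * (a / y) \<le> y * (a / y) ^ M" using assms by (intro mult_left_mono) auto
  thus ?thesis using assms by simp
qed

text \<open>The kernel \<open>N\<close> is a parameter so that the full noise and its truncation are
  treated by one functional.\<close>

definition correlation ::
  "nat \<Rightarrow> nat \<Rightarrow> (int list \<Rightarrow> int list \<Rightarrow> real) \<Rightarrow> (int list \<Rightarrow> real) \<Rightarrow> bool list \<Rightarrow> int list list \<Rightarrow> real" where
  "correlation d n N g x P = (\<Sum>i<n. sgn_bit (x ! i) * (\<Sum>q\<in>cube d. N (P ! i) q * g q))"

lemma sum_correlation_light_le:
  fixes e e' :: "int list \<Rightarrow> 'v"
  assumes \<tau>: "\<And>q. \<bar>\<tau> q\<bar> \<le> 1" and L: "L > 0" and \<delta>: "0 \<le> \<delta>" "\<delta> \<le> 1"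
    and F: "\<And>x P v. \<bar>F x P v\<bar> \<le> (1 :: real)"
    and s: "card (e ` cube d) \<le> s" "card (e' ` cube d) \<le> s"
    and l: "l \<ge> 1" and M: "M = 2 ^ Suc j" and y: "y > 0"
  shows "(\<Sum>x\<in>tuples UNIV n. \<Sum>P\<in>tuples (cube d) n.
      \<bar>correlation d n (light_noise d \<delta> L e e') (\<lambda>q. \<tau> q * F x P (e q) * F x P (e' q)) x P\<bar>)
    \<le> 2 ^ n * (2 ^ d) ^ n * (y + 2 * real s * y * ((n / l + M * L * l) / y) ^ M)"
proof -
  define V where "V = e ` cube d \<union> e' ` cube d"
  define K where "K = n / l + M * L * l"
  define a where "a = (\<lambda>x P. \<bar>correlation d n (light_noise d \<delta> L e e') (\<lambda>q. \<tau> q * F x P (e q) * F x P (e' q)) x P\<bar>)"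
  interpret random_kernel V "cube d" L "\<lambda>v. vol d e v + vol d e' v" "edge_matrix d \<delta> L e e' \<tau>"
    unfolding V_def using \<tau> L \<delta> by (rule random_kernel_edge_matrix)
  have V: "finite V" "e ` cube d \<subseteq> V" "e' ` cube d \<subseteq> V" by (auto simp: V_def)
  have K0: "K \<ge> 0" using l L by (simp add: K_def)
  have a_eq: "\<bar>\<Sum>i<n. sgn_bit (x ! i) * (\<Sum>v\<in>V. \<Sum>u\<in>V. edge_matrix d \<delta> L e e' \<tau> (P ! i) v u * F x P v * F x P u)\<bar>
    = 2 * a x P" for x P
  proof -
    have "(\<Sum>i<n. sgn_bit (x ! i) * (\<Sum>v\<in>V. \<Sum>u\<in>V. edge_matrix d \<delta> L e e' \<tau> (P ! i) v u * F x P v * F x P u))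
      = 2 * correlation d n (light_noise d \<delta> L e e') (\<lambda>q. \<tau> q * F x P (e q) * F x P (e' q)) x P"
      unfolding edge_matrix_form[OF V] correlation_def by (simp add: sum_distrib_left mult_ac)
    thus ?thesis by (simp add: a_def)
  qed
  \<comment> \<open>Each of the two maps has total volume one. The resulting factor
    \<open>2 ^ M\<close> cancels against the doubling of the form by symmetrisation.\<close>
  have "(\<Sum>v\<in>V. vol d e v + vol d e' v) \<le> 2"
    using V by (simp add: sum.distrib sum_vol)
  hence "(\<Sum>x\<in>tuples UNIV n. \<Sum>P\<in>tuples (cube d) n. (2 * a x P) ^ M)
    \<le> 2 ^ n * card (cube d) ^ n * card V * (2 * (n / l + M * L * l)) ^ M"
    unfolding a_eq[symmetric] by (intro sum_form_power_le[OF l M]) (auto simp: F)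
  hence "2 ^ M * (\<Sum>x\<in>tuples UNIV n. \<Sum>P\<in>tuples (cube d) n. a x P ^ M)
      \<le> 2 ^ M * (2 ^ n * (2 ^ d) ^ n * card V * K ^ M)"
    unfolding power_mult_distrib by (simp add: K_def sum_distrib_left mult_ac)
  hence aM: "(\<Sum>x\<in>tuples UNIV n. \<Sum>P\<in>tuples (cube d) n. a x P ^ M) \<le> 2 ^ n * (2 ^ d) ^ n * card V * K ^ M"
    by simp
  have "card V \<le> 2 * s"
    using card_Un_le[of "e ` cube d" "e' ` cube d"] s unfolding V_def by linarith
  hence cV: "real (card V) \<le> 2 * real s" by (metis of_nat_le_iff of_nat_mult of_nat_numeral)
  have "(\<Sum>x\<in>tuples UNIV n. \<Sum>P\<in>tuples (cube d) n. a x P)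
    \<le> (\<Sum>x\<in>tuples (UNIV :: bool set) n. \<Sum>P\<in>tuples (cube d) n. y + y * (a x P / y) ^ M)"
    using y M by (intro sum_mono le_add_power_div) (auto simp: a_def)
  also have "\<dots> = 2 ^ n * (2 ^ d) ^ n * y + y / y ^ M * (\<Sum>x\<in>tuples UNIV n. \<Sum>P\<in>tuples (cube d) n. a x P ^ M)"
    by (simp add: sum.distrib card_tuples power_divide sum_distrib_left)
  also have "\<dots> \<le> 2 ^ n * (2 ^ d) ^ n * y + y / y ^ M * (2 ^ n * (2 ^ d) ^ n * card V * K ^ M)"
    using y by (intro add_left_mono mult_left_mono aM) auto
  also have "\<dots> = 2 ^ n * (2 ^ d) ^ n * (y + card V * (y * (K / y) ^ M))"
    by (simp add: algebra_simps power_divide)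
  also have "\<dots> \<le> 2 ^ n * (2 ^ d) ^ n * (y + (2 * real s) * (y * (K / y) ^ M))"
    using y K0 cV by (intro mult_left_mono add_left_mono mult_right_mono) auto
  finally show ?thesis by (simp add: a_def K_def mult_ac)
qed

text \<open>The light part of the kernel is handled by the trace bound. Removed mass is heavy for at
  least one of two probes and is estimated by absolute values, which gives the factor
  \<open>2 * n\<close> over the \<open>n\<close> points.\<close>

lemma sum_correlation_le:
  fixes e e' :: "int list \<Rightarrow> 'v"
  assumes t: "0 < t" "t < 1" and \<delta>: "0 < \<delta>" "\<delta> < 1 / 2" and L: "L > 0" and \<theta>: "0 < \<theta>" "\<theta> \<le> 1"
    and \<tau>: "\<And>q. \<bar>\<tau> q\<bar> \<le> 1" and F: "\<And>x P v. \<bar>F x P v\<bar> \<le> (1 :: real)"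
    and s: "card (e ` cube d) \<le> s" "card (e' ` cube d) \<le> s"
    and l: "l \<ge> 1" and M: "M = 2 ^ Suc j" and y: "y > 0"
  defines "\<kappa> \<equiv> (L * \<theta> powr ((1 + t) * (1 - 2 * \<delta>)\<^sup>2)) powr (-t)"
  shows "(\<Sum>x\<in>tuples UNIV n. \<Sum>P\<in>tuples (cube d) n.
      correlation d n (noise \<delta>) (\<lambda>q. \<tau> q * F x P (e q) * F x P (e' q)) x P)
    \<le> 2 ^ n * (2 ^ d) ^ n * (y + 2 * real s * y * ((n / l + M * L * l) / y) ^ M + 2 * n * (s * \<theta> + \<kappa>))"
proof -
  define heavy where "heavy = (\<lambda>p. \<Sum>q\<in>cube d. (if light d \<delta> L e p (e q) then 0 else noise \<delta> p q)
     + (if light d \<delta> L e' p (e' q) then 0 else noise \<delta> p q))"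
  define g where "g = (\<lambda>x P q. \<tau> q * F x P (e q) * F x P (e' q))"
  have g: "\<bar>g x P q\<bar> \<le> 1" for x P q
  proof -
    have "\<bar>g x P q\<bar> \<le> 1 * 1 * 1"
      unfolding g_def abs_mult using \<tau> F by (intro mult_mono) auto
    thus ?thesis by simp
  qed
  have split: "correlation d n (noise \<delta>) (g x P) x P
      \<le> \<bar>correlation d n (light_noise d \<delta> L e e') (g x P) x P\<bar> + (\<Sum>i<n. heavy (P ! i))" for x P
  proof -
    have "\<bar>\<Sum>q\<in>cube d. (noise \<delta> p q - light_noise d \<delta> L e e' p q) * g x P q\<bar> \<le> heavy p" for p
      unfolding heavy_def
    proof (rule order_trans[OF sum_abs], rule sum_mono)
      fix q
      have "\<bar>(noise \<delta> p q - light_noise d \<delta> L e e' p q) * g x P q\<bar> \<le> \<bar>noise \<delta> p q - light_noise d \<delta> L e e' p q\<bar> * 1"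
        unfolding abs_mult by (intro mult_left_mono g) auto
      also have "\<dots> \<le> (if light d \<delta> L e p (e q) then 0 else noise \<delta> p q)
         + (if light d \<delta> L e' p (e' q) then 0 else noise \<delta> p q)"
        by (auto simp: light_noise_def)
      finally show "\<bar>(noise \<delta> p q - light_noise d \<delta> L e e' p q) * g x P q\<bar> \<le> \<dots>" .
    qed
    hence "\<bar>sgn_bit (x ! i) * (\<Sum>q\<in>cube d. (noise \<delta> (P ! i) q - light_noise d \<delta> L e e' (P ! i) q) * g x P q)\<bar> \<le> heavy (P ! i)" for i
      by (simp add: abs_mult)
    hence "(\<Sum>i<n. sgn_bit (x ! i) * (\<Sum>q\<in>cube d. (noise \<delta> (P ! i) q - light_noise d \<delta> L e e' (P ! i) q) * g x P q))
       \<le> (\<Sum>i<n. heavy (P ! i))"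
      by (intro sum_mono) (use abs_le_D1 in blast)
    moreover have "correlation d n (noise \<delta>) (g x P) x P - correlation d n (light_noise d \<delta> L e e') (g x P) x P
      = (\<Sum>i<n. sgn_bit (x ! i) * (\<Sum>q\<in>cube d. (noise \<delta> (P ! i) q - light_noise d \<delta> L e e' (P ! i) q) * g x P q))"
      by (simp add: correlation_def sum_subtractf left_diff_distrib right_diff_distrib)
    ultimately show ?thesis by linarith
  qed
  have h: "(\<Sum>p\<in>cube d. heavy p) \<le> 2 ^ d * (2 * (s * \<theta> + \<kappa>))"
    unfolding heavy_def sum.distrib \<kappa>_def
    using add_mono[OF sum_heavy_le[OF t \<delta> L \<theta> s(1)] sum_heavy_le[OF t \<delta> L \<theta> s(2)]]
    by (simp add: algebra_simps)
  have hP: "(\<Sum>P\<in>tuples (cube d) n. \<Sum>i<n. heavy (P ! i)) \<le> (2 ^ d) ^ n * (2 * n * (s * \<theta> + \<kappa>))"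
  proof -
    have "(\<Sum>P\<in>tuples (cube d) n. \<Sum>i<n. heavy (P ! i)) = (\<Sum>i<n. \<Sum>P\<in>tuples (cube d) n. heavy (P ! i))"
      by (rule sum.swap)
    also have "\<dots> \<le> (\<Sum>i<n. (2 ^ d) ^ n * (2 * (s * \<theta> + \<kappa>)))"
    proof (rule sum_mono)
      fix i assume "i \<in> {..<n}"
      hence "2 ^ d * (\<Sum>P\<in>tuples (cube d) n. heavy (P ! i)) = (2 ^ d) ^ n * (\<Sum>p\<in>cube d. heavy p)"
        using sum_tuples_nth[of i n "cube d" heavy] by (simp add: card_tuples)
      also have "\<dots> \<le> (2 ^ d) ^ n * (2 ^ d * (2 * (s * \<theta> + \<kappa>)))"
        using h by (intro mult_left_mono) auto
      finally have "2 ^ d * (\<Sum>P\<in>tuples (cube d) n. heavy (P ! i)) \<le> 2 ^ d * ((2 ^ d) ^ n * (2 * (s * \<theta> + \<kappa>)))"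
        by (simp only: mult_ac)
      thus "(\<Sum>P\<in>tuples (cube d) n. heavy (P ! i)) \<le> (2 ^ d) ^ n * (2 * (s * \<theta> + \<kappa>))"
        by (rule mult_left_le_imp_le) simp
    qed
    finally show ?thesis by (simp add: mult_ac)
  qed
  have "(\<Sum>x\<in>tuples UNIV n. \<Sum>P\<in>tuples (cube d) n. correlation d n (noise \<delta>) (g x P) x P)
    \<le> (\<Sum>x\<in>tuples UNIV n. \<Sum>P\<in>tuples (cube d) n.
        \<bar>correlation d n (light_noise d \<delta> L e e') (g x P) x P\<bar> + (\<Sum>i<n. heavy (P ! i)))"
    by (intro sum_mono split)
  also have "\<dots> = (\<Sum>x\<in>tuples UNIV n. \<Sum>P\<in>tuples (cube d) n. \<bar>correlation d n (light_noise d \<delta> L e e') (g x P) x P\<bar>)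
     + 2 ^ n * (\<Sum>P\<in>tuples (cube d) n. \<Sum>i<n. heavy (P ! i))"
    by (simp add: sum.distrib card_tuples)
  also have "\<dots> \<le> 2 ^ n * (2 ^ d) ^ n * (y + 2 * real s * y * ((n / l + M * L * l) / y) ^ M)
     + 2 ^ n * ((2 ^ d) ^ n * (2 * n * (s * \<theta> + \<kappa>)))"
  proof (rule add_mono)
    show "(\<Sum>x\<in>tuples UNIV n. \<Sum>P\<in>tuples (cube d) n. \<bar>correlation d n (light_noise d \<delta> L e e') (g x P) x P\<bar>)
      \<le> 2 ^ n * (2 ^ d) ^ n * (y + 2 * real s * y * ((n / l + M * L * l) / y) ^ M)"
      unfolding g_def
      by (rule sum_correlation_light_le[where \<tau> = \<tau> and F = F, OF \<tau> L _ _ F s l M y]) (use \<delta> in auto)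
  qed (use hP in auto)
  finally show ?thesis by (simp add: g_def distrib_left mult_ac)
qed

section \<open>Two-probe data structures\<close>

lemma of_bool_eq_sgn_bit: "of_bool (a = b) = (1 + sgn_bit b * sgn_bit a) / 2"
  by (auto simp: sgn_bit_def)

lemma correlation_cong:
  assumes "\<And>q. q \<in> cube d \<Longrightarrow> g q = g' q"
  shows "correlation d n N g x P = correlation d n N g' x P"
  unfolding correlation_def using assms by simp

lemma correlation_sum:
  "correlation d n N (\<lambda>q. \<Sum>u\<in>W. g u q) x P = (\<Sum>u\<in>W. correlation d n N (g u) x P)"
proof -
  have "correlation d n N (\<lambda>q. \<Sum>u\<in>W. g u q) x P
    = (\<Sum>i<n. \<Sum>q\<in>cube d. \<Sum>u\<in>W. sgn_bit (x ! i) * (N (P ! i) q * g u q))"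
    by (simp add: correlation_def sum_distrib_left)
  also have "\<dots> = (\<Sum>u\<in>W. \<Sum>i<n. \<Sum>q\<in>cube d. sgn_bit (x ! i) * (N (P ! i) q * g u q))"
    by (rule trans[OF sum.cong[OF refl sum.swap] sum.swap])
  finally show ?thesis by (simp add: correlation_def sum_distrib_left)
qed

text \<open>Guessing the contents of both cells makes the probes non-adaptive: the sign of the output
  is a sum of \<open>4 ^ w\<close> terms, each bilinear in the indicators of the cell contents.\<close>

lemma sum_output_correlation_le:
  fixes T :: "int list list \<Rightarrow> bool list \<Rightarrow> nat \<Rightarrow> bool list"
    and A1 :: "int list \<Rightarrow> nat" and A2 :: "int list \<Rightarrow> bool list \<Rightarrow> nat"
    and Out :: "int list \<Rightarrow> bool list \<Rightarrow> bool list \<Rightarrow> bool"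
  assumes len: "\<And>P x a. P \<in> tuples (cube d) n \<Longrightarrow> length x = n \<Longrightarrow> a < s \<Longrightarrow> length (T P x a) = w"
    and A1: "\<And>q. q \<in> cube d \<Longrightarrow> A1 q < s"
    and A2: "\<And>q cc. q \<in> cube d \<Longrightarrow> length cc = w \<Longrightarrow> A2 q cc < s"
    and bound: "\<And>(\<tau> :: int list \<Rightarrow> real) (F :: bool list \<Rightarrow> int list list \<Rightarrow> nat \<times> bool list \<Rightarrow> real) e e'.
      (\<And>q. \<bar>\<tau> q\<bar> \<le> 1) \<Longrightarrow> (\<And>x P v. \<bar>F x P v\<bar> \<le> 1) \<Longrightarrow>
      card (e ` cube d) \<le> s \<Longrightarrow> card (e' ` cube d) \<le> s \<Longrightarrow>
      (\<Sum>x\<in>tuples UNIV n. \<Sum>P\<in>tuples (cube d) n.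
        correlation d n N (\<lambda>q. \<tau> q * F x P (e q) * F x P (e' q)) x P) \<le> K"
  shows "(\<Sum>x\<in>tuples UNIV n. \<Sum>P\<in>tuples (cube d) n. correlation d n N
      (\<lambda>q. sgn_bit (Out q (T P x (A1 q)) (T P x (A2 q (T P x (A1 q)))))) x P) \<le> 4 ^ w * K"
proof -
  define W where "W = tuples (UNIV :: bool set) w"
  \<comment> \<open>Vertices are pairs of an address and a guessed content, so one family of
    indicators serves both probes.\<close>
  define F where "F = (\<lambda>x P (a, z). of_bool (T P x a = z) :: real)"
  have fW: "finite W" and cW: "card W = 2 ^ w" by (auto simp: W_def card_tuples)
  have FF: "\<bar>F x P v\<bar> \<le> 1" for x P v by (cases v) (simp add: F_def)
  have expand: "sgn_bit (Out q (T P x (A1 q)) (T P x (A2 q (T P x (A1 q)))))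
      = (\<Sum>u\<in>W. \<Sum>v\<in>W. sgn_bit (Out q u v) * F x P (A1 q, u) * F x P (A2 q u, v))"
    if x: "x \<in> tuples UNIV n" and P: "P \<in> tuples (cube d) n" and q: "q \<in> cube d" for x P q
  proof -
    define c1 where "c1 = T P x (A1 q)"
    have c1: "c1 \<in> W" unfolding c1_def W_def tuples_def
      using len[OF P _ A1[OF q]] x by (simp add: tuples_def)
    hence "A2 q c1 < s" using A2[OF q] by (simp add: W_def tuples_def)
    hence c2: "T P x (A2 q c1) \<in> W" unfolding W_def tuples_def
      using len[OF P] x by (simp add: tuples_def)
    have "(\<Sum>u\<in>W. \<Sum>v\<in>W. sgn_bit (Out q u v) * F x P (A1 q, u) * F x P (A2 q u, v))
      = (\<Sum>u\<in>W. if c1 = u then (\<Sum>v\<in>W. if T P x (A2 q c1) = v then sgn_bit (Out q c1 v) else 0) else 0)"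
      by (intro sum.cong refl) (auto simp: F_def c1_def intro!: sum.cong)
    thus ?thesis using c1 c2 fW by (simp add: c1_def)
  qed
  \<comment> \<open>With the guess fixed, each address gives one vertex, so guessing does not
    enlarge the number of vertices beyond \<open>s\<close>.\<close>
  have img: "card (e ` cube d) \<le> s" if "e ` cube d \<subseteq> {..<s} \<times> {u}" for e :: "int list \<Rightarrow> nat \<times> bool list" and u
    using card_mono[OF _ that] by simp
  have "(\<Sum>x\<in>tuples UNIV n. \<Sum>P\<in>tuples (cube d) n. correlation d n N
      (\<lambda>q. sgn_bit (Out q (T P x (A1 q)) (T P x (A2 q (T P x (A1 q)))))) x P)
    = (\<Sum>x\<in>tuples UNIV n. \<Sum>P\<in>tuples (cube d) n. \<Sum>u\<in>W. \<Sum>v\<in>W. correlation d n N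
      (\<lambda>q. sgn_bit (Out q u v) * F x P (A1 q, u) * F x P (A2 q u, v)) x P)"
    unfolding correlation_sum[symmetric] by (intro sum.cong refl correlation_cong expand)
  also have "\<dots> = (\<Sum>u\<in>W. \<Sum>x\<in>tuples UNIV n. \<Sum>P\<in>tuples (cube d) n. \<Sum>v\<in>W. correlation d n N
      (\<lambda>q. sgn_bit (Out q u v) * F x P (A1 q, u) * F x P (A2 q u, v)) x P)"
    by (rule trans[OF sum.cong[OF refl sum.swap] sum.swap])
  also have "\<dots> = (\<Sum>u\<in>W. \<Sum>v\<in>W. \<Sum>x\<in>tuples UNIV n. \<Sum>P\<in>tuples (cube d) n. correlation d n N
      (\<lambda>q. sgn_bit (Out q u v) * F x P (A1 q, u) * F x P (A2 q u, v)) x P)"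
    by (rule sum.cong[OF refl], rule trans[OF sum.cong[OF refl sum.swap] sum.swap])
  also have "\<dots> \<le> (\<Sum>u\<in>W. \<Sum>v\<in>W. K)"
  proof (intro sum_mono)
    fix u v assume u: "u \<in> W" and v: "v \<in> W"
    show "(\<Sum>x\<in>tuples UNIV n. \<Sum>P\<in>tuples (cube d) n. correlation d n N
      (\<lambda>q. sgn_bit (Out q u v) * F x P (A1 q, u) * F x P (A2 q u, v)) x P) \<le> K"
    proof (rule bound[where \<tau> = "\<lambda>q. sgn_bit (Out q u v)" and F = F and e = "\<lambda>q. (A1 q, u)" and e' = "\<lambda>q. (A2 q u, v)"])
      show "card ((\<lambda>q. (A1 q, u)) ` cube d) \<le> s" by (rule img[of _ u]) (auto simp: A1)
      show "card ((\<lambda>q. (A2 q u, v)) ` cube d) \<le> s"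
        using u by (intro img[of _ v]) (auto simp: A2 W_def tuples_def)
    qed (auto simp: FF)
  qed
  also have "\<dots> = 4 ^ w * K"
    by (simp add: cW flip: power_mult_distrib)
  finally show ?thesis .
qed

section \<open>Success probability expressed through correlation\<close>

lemma measure_bind_pmf:
  "measure (measure_pmf (bind_pmf M f)) A = (\<integral>x. measure (measure_pmf (f x)) A \<partial>measure_pmf M)"
  unfolding measure_pmf_bind
  by (rule measure_pmf.measure_bind[where N = "count_space UNIV"]) (auto simp: measure_subprob)

lemma measure_noise_pmf:
  assumes "p \<in> cube d"
  shows "measure (measure_pmf (noise_pmf \<delta> p)) A = (\<Sum>q\<in>cube d. noise \<delta> p q * of_bool (q \<in> A))"
proof -
  have "measure (measure_pmf (noise_pmf \<delta> p)) A = measure (measure_pmf (noise_pmf \<delta> p)) (A \<inter> cube d)"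
    by (rule measure_pmf.finite_measure_eq_AE)
      (use set_noise_pmf[OF assms, of \<delta>] in \<open>auto simp: AE_measure_pmf_iff\<close>)
  also have "\<dots> = (\<Sum>q\<in>A \<inter> cube d. noise \<delta> p q)"
    by (simp add: measure_measure_pmf_finite)
  also have "\<dots> = (\<Sum>q\<in>cube d. if q \<in> A then noise \<delta> p q else 0)"
    by (simp add: sum.If_cases Int_commute Int_def conj_commute)
  also have "\<dots> = (\<Sum>q\<in>cube d. noise \<delta> p q * of_bool (q \<in> A))"
    by (intro sum.cong) auto
  finally show ?thesis .
qed

lemma measure_query_pmf:
  assumes P: "P \<in> tuples (cube d) n" and n: "n > 0"
  shows "measure (measure_pmf (query_pmf c P)) A
    = (\<Sum>i<n. \<Sum>q\<in>cube d. noise (1 / (2 * c)) (P ! i) q * of_bool ((i, q) \<in> A)) / n"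
proof -
  have l: "length P = n" using P by (simp add: tuples_def)
  have "measure (measure_pmf (query_pmf c P)) A
    = (\<Sum>i<n. measure (measure_pmf (map_pmf (\<lambda>q. (i, q)) (noise_pmf (1 / (2 * c)) (P ! i)))) A) / n"
    unfolding query_pmf_def measure_bind_pmf l
    using n by (subst integral_pmf_of_set) auto
  also have "(\<Sum>i<n. measure (measure_pmf (map_pmf (\<lambda>q. (i, q)) (noise_pmf (1 / (2 * c)) (P ! i)))) A)
    = (\<Sum>i<n. \<Sum>q\<in>cube d. noise (1 / (2 * c)) (P ! i) q * of_bool ((i, q) \<in> A))"
  proof (rule sum.cong[OF refl])
    fix i assume "i \<in> {..<n}"
    hence "P ! i \<in> cube d" using P by (simp add: nth_in_tuples)
    thus "measure (measure_pmf (map_pmf (\<lambda>q. (i, q)) (noise_pmf (1 / (2 * c)) (P ! i)))) A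
      = (\<Sum>q\<in>cube d. noise (1 / (2 * c)) (P ! i) q * of_bool ((i, q) \<in> A))"
      by (simp add: measure_noise_pmf)
  qed
  finally show ?thesis .
qed

definition success_given ::
  "real \<Rightarrow> nat \<Rightarrow> nat \<Rightarrow> (int list list \<Rightarrow> bool list \<Rightarrow> nat \<Rightarrow> bool list)
   \<Rightarrow> (int list \<Rightarrow> nat) \<Rightarrow> (int list \<Rightarrow> bool list \<Rightarrow> nat)
   \<Rightarrow> (int list \<Rightarrow> bool list \<Rightarrow> bool list \<Rightarrow> bool) \<Rightarrow> bool list \<Rightarrow> real" where
  "success_given c n d T A1 A2 Out x = measure (measure_pmf (bind_pmf (dataset_pmf n d) (\<lambda>P.
     map_pmf (\<lambda>(i, q). (P, i, q)) (query_pmf c P))))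
     {(P, i, q). Out q (T P x (A1 q)) (T P x (A2 q (T P x (A1 q)))) = x ! i}"

lemma success_prob_eq_integral:
  "success_prob c n d R T A1 A2 Out x
    = (\<integral>r. success_given c n d (T r) (A1 r) (A2 r) (Out r) x \<partial>measure_pmf R)"
  unfolding success_prob_def success_given_def measure_bind_pmf
  by (intro Bochner_Integration.integral_cong refl)
    (auto simp: Let_def case_prod_beta intro!: arg_cong[where f = "measure _"])

text \<open>Agreement of two bits is half of one plus the product of their signs. The constant gives
  success \<open>1 / 2\<close> on average over \<open>x\<close>, and the correlation measures the
  advantage over it.\<close>

lemma sum_success_given:
  assumes n: "n > 0"
  shows "(\<Sum>x\<in>tuples UNIV n. success_given c n d T A1 A2 Out x)
    = 2 ^ n / 2 + (\<Sum>x\<in>tuples UNIV n. \<Sum>P\<in>tuples (cube d) n. correlation d n (noise (1 / (2 * c)))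
        (\<lambda>q. sgn_bit (Out q (T P x (A1 q)) (T P x (A2 q (T P x (A1 q)))))) x P) / (2 * n * (2 ^ d) ^ n)"
proof -
  define out where "out = (\<lambda>x P q. Out q (T P x (A1 q)) (T P x (A2 q (T P x (A1 q)))))"
  have fin: "finite (tuples (cube d) n)" by simp
  have ds: "dataset_pmf n d = pmf_of_set (tuples (cube d) n)"
    by (simp add: dataset_pmf_def tuples_def)
  have ne: "tuples (cube d) n \<noteq> {}"
    using card_tuples[of "cube d" n] by (metis card.empty card_cube finite_cube power_eq_0_iff zero_neq_numeral)
  have half: "(\<Sum>i<n. \<Sum>q\<in>cube d. noise (1 / (2 * c)) (P ! i) q * of_bool (out x P q = x ! i))
    = n / 2 + correlation d n (noise (1 / (2 * c))) (\<lambda>q. sgn_bit (out x P q)) x P / 2"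
    if P: "P \<in> tuples (cube d) n" for x P
  proof -
    have "(\<Sum>i<n. \<Sum>q\<in>cube d. noise (1 / (2 * c)) (P ! i) q * of_bool (out x P q = x ! i))
      = (\<Sum>i<n. (\<Sum>q\<in>cube d. noise (1 / (2 * c)) (P ! i) q) / 2
         + sgn_bit (x ! i) * (\<Sum>q\<in>cube d. noise (1 / (2 * c)) (P ! i) q * sgn_bit (out x P q)) / 2)"
      unfolding of_bool_eq_sgn_bit
      by (simp add: distrib_left add_divide_distrib sum.distrib sum_divide_distrib sum_distrib_left mult_ac)
    also have "\<dots> = (\<Sum>i<n. 1 / 2
         + sgn_bit (x ! i) * (\<Sum>q\<in>cube d. noise (1 / (2 * c)) (P ! i) q * sgn_bit (out x P q)) / 2)"
      using P by (intro sum.cong refl) (simp add: sum_noise_right[where d = d] nth_in_tuples)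
    finally show ?thesis by (simp add: correlation_def sum.distrib sum_divide_distrib)
  qed
  have g: "success_given c n d T A1 A2 Out x = (\<Sum>P\<in>tuples (cube d) n. (n / 2
      + correlation d n (noise (1 / (2 * c))) (\<lambda>q. sgn_bit (out x P q)) x P / 2) / n) / (2 ^ d) ^ n" for x
  proof -
    have "success_given c n d T A1 A2 Out x = (\<Sum>P\<in>tuples (cube d) n.
        measure (measure_pmf (map_pmf (\<lambda>(i, q). (P, i, q)) (query_pmf c P)))
          {(P, i, q). out x P q = x ! i}) / (2 ^ d) ^ n"
      unfolding success_given_def measure_bind_pmf ds out_def
      by (subst integral_pmf_of_set[OF ne fin]) (simp add: card_tuples)
    also have "(\<Sum>P\<in>tuples (cube d) n.
        measure (measure_pmf (map_pmf (\<lambda>(i, q). (P, i, q)) (query_pmf c P))) {(P, i, q). out x P q = x ! i})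
      = (\<Sum>P\<in>tuples (cube d) n. (\<Sum>i<n. \<Sum>q\<in>cube d. noise (1 / (2 * c)) (P ! i) q * of_bool (out x P q = x ! i)) / n)"
      by (rule sum.cong[OF refl]) (simp add: measure_query_pmf[OF _ n])
    also have "\<dots> = (\<Sum>P\<in>tuples (cube d) n. (n / 2
      + correlation d n (noise (1 / (2 * c))) (\<lambda>q. sgn_bit (out x P q)) x P / 2) / n)"
      by (rule sum.cong[OF refl]) (simp only: half)
    finally show ?thesis .
  qed
  have "(\<Sum>x\<in>tuples UNIV n. success_given c n d T A1 A2 Out x) = 2 ^ n / 2 + (\<Sum>x\<in>tuples UNIV n. \<Sum>P\<in>tuples (cube d) n.
        correlation d n (noise (1 / (2 * c))) (\<lambda>q. sgn_bit (out x P q)) x P) / (2 * n * (2 ^ d) ^ n)"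
    using n unfolding g
    by (simp add: add_divide_distrib sum.distrib card_tuples sum_divide_distrib mult_ac)
  thus ?thesis by (simp add: out_def)
qed

text \<open>Success for every \<open>x\<close> implies success on average over uniform
  \<open>x\<close>. After exchanging this average with the one over \<open>R\<close>, it suffices to
  bound each fixed random string.\<close>

lemma success_prob_bound:
  assumes n: "n > 0" and valid: "valid_two_probe d n w s T A1 A2"
    and success: "\<And>x. length x = n \<Longrightarrow> success_prob c n d R T A1 A2 Out x \<ge> \<alpha>"
    and bound: "\<And>(\<tau> :: int list \<Rightarrow> real) (F :: bool list \<Rightarrow> int list list \<Rightarrow> nat \<times> bool list \<Rightarrow> real) e e'.
      (\<And>q. \<bar>\<tau> q\<bar> \<le> 1) \<Longrightarrow> (\<And>x P v. \<bar>F x P v\<bar> \<le> 1) \<Longrightarrow>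
      card (e ` cube d) \<le> s \<Longrightarrow> card (e' ` cube d) \<le> s \<Longrightarrow>
      (\<Sum>x\<in>tuples UNIV n. \<Sum>P\<in>tuples (cube d) n.
        correlation d n (noise (1 / (2 * c))) (\<lambda>q. \<tau> q * F x P (e q) * F x P (e' q)) x P)
      \<le> 2 ^ n * (2 ^ d) ^ n * Z"
  shows "\<alpha> \<le> 1 / 2 + 4 ^ w * Z / (2 * real n)"
proof -
  define g where "g = (\<lambda>r. success_given c n d (T r) (A1 r) (A2 r) (Out r))"
  have g01: "0 \<le> g r x" "g r x \<le> 1" for r x by (auto simp: g_def success_given_def)
  have int: "integrable (measure_pmf R) (\<lambda>r. g r x)" for x
    by (rule measure_pmf.integrable_const_bound[where B = 1]) (auto simp: g01)
  have le: "(\<Sum>x\<in>tuples UNIV n. g r x) \<le> 2 ^ n * (1 / 2 + 4 ^ w * Z / (2 * real n))" for r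
  proof -
    have "(\<Sum>x\<in>tuples UNIV n. \<Sum>P\<in>tuples (cube d) n. correlation d n (noise (1 / (2 * c)))
        (\<lambda>q. sgn_bit (Out r q (T r P x (A1 r q)) (T r P x (A2 r q (T r P x (A1 r q)))))) x P)
      \<le> 4 ^ w * (2 ^ n * (2 ^ d) ^ n * Z)"
      using valid by (intro sum_output_correlation_le[where s = s] bound) (auto simp: valid_two_probe_def tuples_def)
    hence "(\<Sum>x\<in>tuples UNIV n. g r x) \<le> 2 ^ n / 2 + 4 ^ w * (2 ^ n * (2 ^ d) ^ n * Z) / (2 * n * (2 ^ d) ^ n)"
      unfolding g_def sum_success_given[OF n] using n by (intro add_left_mono divide_right_mono) auto
    also have "\<dots> = 2 ^ n * (1 / 2 + 4 ^ w * Z / (2 * real n))"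
      using n by (simp add: field_simps)
    finally show ?thesis .
  qed
  have "2 ^ n * \<alpha> = (\<Sum>x\<in>tuples (UNIV :: bool set) n. \<alpha>)" by (simp add: card_tuples)
  also have "\<dots> \<le> (\<Sum>x\<in>tuples UNIV n. success_prob c n d R T A1 A2 Out x)"
    by (intro sum_mono success) (simp add: tuples_def)
  also have "\<dots> = (\<integral>r. (\<Sum>x\<in>tuples UNIV n. g r x) \<partial>measure_pmf R)"
    unfolding success_prob_eq_integral g_def[symmetric] using int
    by (subst Bochner_Integration.integral_sum) (auto simp: g_def)
  also have "\<dots> \<le> 2 ^ n * (1 / 2 + 4 ^ w * Z / (2 * real n))"
    using le int by (intro measure_pmf.integral_le_const) auto
  finally show ?thesis by simp
qed

section \<open>Choice of parameters and asymptotics\<close>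

lemma two_probe_tradeoff:
  fixes c :: real
  assumes c: "c > 1" and n: "n > 0" and valid: "valid_two_probe d n w s T A1 A2"
    and success: "\<And>x. length x = n \<Longrightarrow> success_prob c n d R T A1 A2 Out x \<ge> \<alpha>"
    and t: "0 < t" "t < 1" and L: "L > 0" and \<theta>: "0 < \<theta>" "\<theta> \<le> 1"
    and l: "l \<ge> 1" and M: "M = 2 ^ Suc j" and y: "y > 0"
  defines "\<kappa> \<equiv> (L * \<theta> powr ((1 + t) * (1 - 1 / c)\<^sup>2)) powr (-t)"
  shows "\<alpha> \<le> 1 / 2 + 4 ^ w * (y + 2 * real s * y * ((n / l + M * L * l) / y) ^ M + 2 * real n * (real s * \<theta> + \<kappa>)) / (2 * real n)"
proof (rule success_prob_bound[OF n valid success])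
  fix \<tau> :: "int list \<Rightarrow> real" and F :: "bool list \<Rightarrow> int list list \<Rightarrow> nat \<times> bool list \<Rightarrow> real"
    and e e' :: "int list \<Rightarrow> nat \<times> bool list"
  assume *: "\<And>q. \<bar>\<tau> q\<bar> \<le> 1" "\<And>x P v. \<bar>F x P v\<bar> \<le> 1" "card (e ` cube d) \<le> s" "card (e' ` cube d) \<le> s"
  have \<delta>: "0 < 1 / (2 * c)" "1 / (2 * c) < 1 / 2" using c by auto
  have e: "1 - 2 * (1 / (2 * c)) = 1 - 1 / c" by simp
  show "(\<Sum>x\<in>tuples UNIV n. \<Sum>P\<in>tuples (cube d) n.
        correlation d n (noise (1 / (2 * c))) (\<lambda>q. \<tau> q * F x P (e q) * F x P (e' q)) x P)
      \<le> 2 ^ n * (2 ^ d) ^ n * (y + 2 * real s * y * ((n / l + M * L * l) / y) ^ M + 2 * real n * (real s * \<theta> + \<kappa>))"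
    using sum_correlation_le[where \<tau> = \<tau> and F = F, OF t \<delta> L \<theta> *(1,2,3,4) l M y] unfolding e \<kappa>_def .
qed

text \<open>Every parameter is a power of \<open>N\<close> and \<open>t\<close> measures the slack.
  With \<open>c\<close> and \<open>t\<close> fixed, \<open>M\<close> can be chosen independently of
  \<open>n\<close>, so its prefactor is a constant and all errors are of order
  \<open>N powr (- (t\<^sup>2 / 2))\<close> apart from \<open>4 ^ w\<close>.\<close>

lemma two_probe_success_le:
  fixes c t :: real and n :: nat
  defines "\<kappa>\<^sub>0 \<equiv> (c / (c - 1))\<^sup>2" and "N \<equiv> real n"
  assumes c: "c > 1" and n: "n > 0" and valid: "valid_two_probe d n w s T A1 A2"
    and success: "\<And>x. length x = n \<Longrightarrow> success_prob c n d R T A1 A2 Out x \<ge> \<alpha>"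
    and t: "0 < t" "t \<le> 1 / 4" and M: "M = 2 ^ Suc j" "\<kappa>\<^sub>0 \<le> M * t / 8"
    and s: "real s < N powr (\<kappa>\<^sub>0 - 4 * t * \<kappa>\<^sub>0)"
  shows "\<alpha> \<le> 1 / 2 + 4 ^ w * ((5 + 2 * (1 + real M) ^ M) * N powr (- (t\<^sup>2 / 2))) / 2"
proof -
  define r where "r = (1 - 1 / c)\<^sup>2"
  have N: "N \<ge> 1" using n by (simp add: N_def)
  have "c / (c - 1) > 1" using c by (simp add: less_divide_eq)
  hence k1: "\<kappa>\<^sub>0 \<ge> 1" unfolding \<kappa>\<^sub>0_def by (simp add: one_le_power)
  have "c / (c - 1) * (1 - 1 / c) = 1" using c by (simp add: field_simps)
  \<comment> \<open>The threshold exponent is the reciprocal of the squared noise correlation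
    \<open>1 - 1 / c\<close>.\<close>
  hence kr: "\<kappa>\<^sub>0 * r = 1" by (simp only: \<kappa>\<^sub>0_def r_def power_mult_distrib[symmetric] power_one)
  define L where "L = N powr (1 - t / 2)"
  \<comment> \<open>Half of the slack \<open>4 * t * \<kappa>\<^sub>0\<close> in the table size
    makes \<open>s * \<theta>\<close> small; the other half is left for the bound on
    \<open>\<kappa>\<close>.\<close>
  define \<theta> where "\<theta> = N powr (- (\<kappa>\<^sub>0 - 2 * t * \<kappa>\<^sub>0))"
  \<comment> \<open>This choice balances \<open>N / l\<close> and \<open>L * l\<close> at
    \<open>N powr (1 - t / 4)\<close>.\<close>
  define l where "l = N powr (t / 4)"
  \<comment> \<open>The threshold lies between that balanced value and \<open>N\<close>. Its ratio
    to the former is \<open>N powr (t / 8)\<close>, whose \<open>M\<close>-th power exceeds any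
    admissible table size.\<close>
  define y where "y = N powr (1 - t / 8)"
  define \<kappa> where "\<kappa> = (L * \<theta> powr ((1 + t) * r)) powr (-t)"
  define \<eta> where "\<eta> = N powr (- (t\<^sup>2 / 2))"
  have mono: "N powr a \<le> N powr b" if "a \<le> b" for a b using N that by (rule powr_mono[rotated])
  have "2 * t * \<kappa>\<^sub>0 \<le> 1 * \<kappa>\<^sub>0" using t k1 by (intro mult_right_mono) auto
  hence \<theta>: "0 < \<theta>" "\<theta> \<le> 1" using N mono[of "- (\<kappa>\<^sub>0 - 2 * t * \<kappa>\<^sub>0)" 0] by (auto simp: \<theta>_def)
  have L: "L > 0" and y: "y > 0" using N by (auto simp: L_def y_def)
  have l: "l \<ge> 1" using N t by (simp add: l_def ge_one_powr_ge_zero)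
  have tt: "t * t \<le> t * (1 / 4)" using t by (intro mult_left_mono) auto
  have K: "n / l + M * L * l = (1 + real M) * N powr (1 - t / 4)"
  proof -
    have "N / l = N powr (1 - t / 4)" using N by (simp add: l_def powr_diff)
    moreover have "L * l = N powr (1 - t / 4)" by (simp add: L_def l_def powr_add[symmetric])
    ultimately show ?thesis by (simp add: N_def algebra_simps)
  qed
  have Ky: "((n / l + M * L * l) / y) ^ M \<le> (1 + real M) ^ M * N powr (- \<kappa>\<^sub>0)"
  proof -
    have "(n / l + M * L * l) / y = (1 + real M) * N powr (- (t / 8))"
      unfolding K y_def times_divide_eq_right[symmetric] powr_diff[symmetric] by simp
    hence "((n / l + M * L * l) / y) ^ M = (1 + real M) ^ M * N powr (- (t / 8) * M)"
      using N by (simp add: power_mult_distrib powr_powr powr_realpow[symmetric])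
    also have "\<dots> \<le> (1 + real M) ^ M * N powr (- \<kappa>\<^sub>0)"
      using M(2) by (intro mult_left_mono mono) (auto simp: mult_ac)
    finally show ?thesis .
  qed
  \<comment> \<open>Since \<open>t \<le> 1 / 4\<close>, the saving \<open>t / 8\<close> in
    \<open>y\<close> is at least \<open>t\<^sup>2 / 2\<close>.\<close>
  have yN: "y \<le> N * \<eta>"
  proof -
    have "y \<le> N powr (1 + - (t\<^sup>2 / 2))"
      unfolding y_def using tt t by (intro mono) (simp add: power2_eq_square)
    also have "\<dots> = N * \<eta>" unfolding \<eta>_def powr_add using N by simp
    finally show ?thesis .
  qed
  have main: "y + 2 * real s * y * ((n / l + M * L * l) / y) ^ M \<le> (1 + 2 * (1 + real M) ^ M) * (N * \<eta>)"
  proof -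
    have "real s \<le> N powr \<kappa>\<^sub>0" using s mono[of "\<kappa>\<^sub>0 - 4 * t * \<kappa>\<^sub>0" \<kappa>\<^sub>0] t k1 by auto
    hence "real s * ((n / l + M * L * l) / y) ^ M \<le> N powr \<kappa>\<^sub>0 * ((1 + real M) ^ M * N powr (- \<kappa>\<^sub>0))"
      using Ky l L y by (intro mult_mono) auto
    also have "\<dots> = (1 + real M) ^ M" using N by (simp add: powr_minus)
    finally have "y * (1 + 2 * (real s * ((n / l + M * L * l) / y) ^ M)) \<le> (N * \<eta>) * (1 + 2 * (1 + real M) ^ M)"
      using yN y l L by (intro mult_mono) (auto intro!: add_nonneg_nonneg)
    thus ?thesis by (simp add: algebra_simps)
  qed
  have s\<theta>: "s * \<theta> \<le> \<eta>"
  proof -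
    have "s * \<theta> \<le> N powr (\<kappa>\<^sub>0 - 4 * t * \<kappa>\<^sub>0) * \<theta>"
      using s \<theta> by (intro mult_right_mono) auto
    also have "\<dots> = N powr (- (2 * t * \<kappa>\<^sub>0))" by (simp add: \<theta>_def powr_add[symmetric] mult_ac)
    also have "\<dots> \<le> \<eta>"
    proof -
      have "2 * t * 1 \<le> 2 * t * \<kappa>\<^sub>0" using t k1 by (intro mult_left_mono) auto
      thus ?thesis unfolding \<eta>_def using tt t by (intro mono) (simp add: power2_eq_square)
    qed
    finally show ?thesis .
  qed
  have \<kappa>: "\<kappa> \<le> \<eta>"
  proof -
    have e: "- (\<kappa>\<^sub>0 - 2 * t * \<kappa>\<^sub>0) * ((1 + t) * r) = - ((1 - 2 * t) * (1 + t))"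
    proof -
      have "- (\<kappa>\<^sub>0 - 2 * t * \<kappa>\<^sub>0) * ((1 + t) * r) = - ((1 - 2 * t) * (1 + t)) * (\<kappa>\<^sub>0 * r)"
        by (simp add: algebra_simps)
      thus ?thesis by (simp add: kr)
    qed
    have "\<kappa> = N powr ((1 - t / 2 - (1 - 2 * t) * (1 + t)) * (- t))"
      unfolding \<kappa>_def L_def \<theta>_def powr_powr e by (simp add: powr_powr powr_add[symmetric])
    \<comment> \<open>The lower-order terms leave \<open>t / 2 + 2 * t\<^sup>2\<close> in the
      bracket, a positive margin.\<close>
    also have "(1 - t / 2 - (1 - 2 * t) * (1 + t)) * (- t) = - (t\<^sup>2 / 2) - 2 * t ^ 3"
      by (simp add: algebra_simps power2_eq_square power3_eq_cube)
    finally show ?thesis unfolding \<eta>_def using t by (simp add: mono)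
  qed
  have "\<alpha> \<le> 1 / 2 + 4 ^ w * (y + 2 * real s * y * ((n / l + M * L * l) / y) ^ M + 2 * real n * (real s * \<theta> + \<kappa>)) / (2 * real n)"
    unfolding \<kappa>_def r_def using t by (intro two_probe_tradeoff[OF c n valid success _ _ L \<theta> l M(1) y]) auto
  \<comment> \<open>Of the constant 5 below, one comes from \<open>y\<close> and four from the two
    heavy errors after division by \<open>n\<close>.\<close>
  also have "\<dots> \<le> 1 / 2 + 4 ^ w * ((1 + 2 * (1 + real M) ^ M) * (N * \<eta>) + 2 * real n * (\<eta> + \<eta>)) / (2 * real n)"
    using s\<theta> \<kappa> main by (intro add_left_mono divide_right_mono mult_left_mono add_mono) auto
  also have "\<dots> = 1 / 2 + 4 ^ w * ((5 + 2 * (1 + real M) ^ M) * \<eta>) / 2"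
    using n by (simp add: N_def field_simps)
  finally show ?thesis by (simp add: \<eta>_def)
qed

theorem theorem1p4:
  fixes c :: real and d w s :: "nat \<Rightarrow> nat"
    and R :: "nat \<Rightarrow> 'r pmf"
    and T :: "nat \<Rightarrow> 'r \<Rightarrow> int list list \<Rightarrow> bool list \<Rightarrow> nat \<Rightarrow> bool list"
    and A1 :: "nat \<Rightarrow> 'r \<Rightarrow> int list \<Rightarrow> nat"
    and A2 :: "nat \<Rightarrow> 'r \<Rightarrow> int list \<Rightarrow> bool list \<Rightarrow> nat"
    and Out :: "nat \<Rightarrow> 'r \<Rightarrow> int list \<Rightarrow> bool list \<Rightarrow> bool list \<Rightarrow> bool"
  assumes "c > 1"
    and "filterlim (\<lambda>n. real (d n) / ln (real n)) at_top sequentially"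
    and "(\<lambda>n. real (w n) / ln (real n)) \<longlonglongrightarrow> 0"
    and "\<forall>\<^sub>F n in sequentially. valid_two_probe (d n) n (w n) (s n) (T n) (A1 n) (A2 n)"
    and "\<forall>\<^sub>F n in sequentially. \<forall>x. length x = n \<longrightarrow>
           success_prob c n (d n) (R n) (T n) (A1 n) (A2 n) (Out n) x \<ge> 2 / 3"
  shows "\<forall>\<epsilon>>0. \<forall>\<^sub>F n in sequentially. real (s n) \<ge> real n powr ((c / (c - 1))\<^sup>2 - \<epsilon>)"
proof (intro allI impI)
  fix \<epsilon> :: real assume \<epsilon>: "\<epsilon> > 0"
  define \<kappa>\<^sub>0 where "\<kappa>\<^sub>0 = (c / (c - 1))\<^sup>2"
  \<comment> \<open>Capping at \<open>\<kappa>\<^sub>0\<close> ensures \<open>t \<le> 1 / 4\<close>,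
    while a smaller \<epsilon> only strengthens the claim.\<close>
  define \<epsilon>' where "\<epsilon>' = min \<epsilon> \<kappa>\<^sub>0"
  define t where "t = \<epsilon>' / (4 * \<kappa>\<^sub>0)"
  have k: "\<kappa>\<^sub>0 > 0" using assms(1) by (simp add: \<kappa>\<^sub>0_def)
  have t: "0 < t" "t \<le> 1 / 4" using k \<epsilon> by (auto simp: t_def \<epsilon>'_def divide_le_eq)
  have kt: "4 * t * \<kappa>\<^sub>0 = \<epsilon>'" using k by (simp add: t_def)
  obtain j where j: "8 * \<kappa>\<^sub>0 / t < 2 ^ j" using real_arch_pow[of 2] by auto
  define M :: nat where "M = 2 ^ Suc j"
  have "(2 :: real) ^ j \<le> real M" by (simp add: M_def)
  hence "8 * \<kappa>\<^sub>0 / t < real M" using j by linarith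
  hence M: "\<kappa>\<^sub>0 \<le> M * t / 8" using t by (simp add: divide_less_eq)
  define C where "C = 5 + 2 * (1 + real M) ^ M"
  have C: "C > 0" by (simp add: C_def add_pos_nonneg)
  \<comment> \<open>The threshold makes \<open>4 ^ w n\<close> at most
    \<open>n powr (t\<^sup>2 / 4)\<close>, which spends half of the saving
    \<open>t\<^sup>2 / 2\<close> and keeps the rest.\<close>
  have "\<forall>\<^sub>F n in sequentially. real (w n) / ln (real n) < t\<^sup>2 / (4 * ln 4)"
    by (rule order_tendstoD[OF assms(3)]) (use t in simp)
  moreover have "\<forall>\<^sub>F n in sequentially. C * real n powr (- (t\<^sup>2 / 4)) < 1 / 3"
  proof -
    have "(\<lambda>n. C * real n powr (- (t\<^sup>2 / 4))) \<longlonglongrightarrow> C * 0"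
      using t by (intro tendsto_mult tendsto_const tendsto_neg_powr filterlim_real_sequentially) auto
    thus ?thesis by (intro order_tendstoD) auto
  qed
  ultimately show "\<forall>\<^sub>F n in sequentially. real (s n) \<ge> real n powr ((c / (c - 1))\<^sup>2 - \<epsilon>)"
    using assms(4,5) eventually_ge_at_top[of 2]
  proof eventually_elim
    case (elim n)
    have n: "n > 0" and lnn: "ln (real n) > 0" using elim(5) by auto
    show ?case
    proof (rule ccontr)
      assume "\<not> ?thesis"
      hence "real (s n) < real n powr (\<kappa>\<^sub>0 - \<epsilon>)" by (simp add: \<kappa>\<^sub>0_def)
      also have "\<dots> \<le> real n powr (\<kappa>\<^sub>0 - 4 * t * \<kappa>\<^sub>0)"
        unfolding kt using n by (intro powr_mono) (auto simp: \<epsilon>'_def)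
      finally have s: "real (s n) < real n powr (\<kappa>\<^sub>0 - 4 * t * \<kappa>\<^sub>0)" .
      have "2 / 3 \<le> 1 / 2 + 4 ^ w n * ((5 + 2 * (1 + real M) ^ M) * real n powr (- (t\<^sup>2 / 2))) / 2"
        by (rule two_probe_success_le[where R = "R n" and Out = "Out n", OF assms(1) n elim(3) _ t M_def])
          (use elim(4) s M in \<open>simp_all add: \<kappa>\<^sub>0_def\<close>)
      \<comment> \<open>The advantage \<open>2 / 3 - 1 / 2 = 1 / 6\<close> is doubled by clearing
        the final division by two.\<close>
      hence "1 / 3 \<le> 4 ^ w n * (C * real n powr (- (t\<^sup>2 / 2)))"
        unfolding C_def by simp
      also have "\<dots> \<le> real n powr (t\<^sup>2 / 4) * (C * real n powr (- (t\<^sup>2 / 2)))"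
      proof (rule mult_right_mono)
        have "real (w n) * ln 4 \<le> t\<^sup>2 / 4 * ln (real n)"
          using elim(1) lnn by (simp add: field_simps)
        hence "exp (real (w n) * ln 4) \<le> exp (t\<^sup>2 / 4 * ln (real n))" by simp
        thus "4 ^ w n \<le> real n powr (t\<^sup>2 / 4)"
          using n by (simp add: powr_def exp_of_nat_mult)
      qed (use C in auto)
      also have "\<dots> = C * real n powr (- (t\<^sup>2 / 4))"
        by (simp add: powr_add[symmetric] mult.left_commute)
      finally show False using elim(2) by simp
    qed
  qed
qed

end
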